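(* Let $b>1$ be an integer and $d\in\{0,\dots,b-1\}$. For every $k\ge1$, and also for $k=0$ if $d=0$, $b^{-1}I(b,d,k)$ is exactly represented by the absolutely convergent series $$b^{-1}I(b,d,k)=\sum_{j=1}^\infty c_j(b,d)\,F_j(b,d)\,\lambda_j^{k+1}.$$ Further, for $k=0$ and $d>0$, with $(b,d)\neq(2,1)$, there holds, with the same $c_j(b,d)$, $$b^{-1}I(b,d,0)=\sum_{j=1}^\infty c_j(b,d)\,F_j^*(b,d)\,\lambda_j,$$ again with an absolutely convergent series.
   Context: For an integer $n>0$, $k_d(n)$ is the number of digits equal to $d$ in the base-$b$ representation of $n$ without leading zeros, and $I(b,d,k)=\sum_{n>0,\,k_d(n)=k}\frac1n$. For $j\ge1$, $\lambda_j=(b^j-b+1)^{-1}$, and $\nu_j=\nu_{b,d,j}$ is the probability measure on $[0,1)$ which is the law of $\sum_{i\ge1}d_ib^{-i}$, where the digits $d_i\in\{0,\dots,b-1\}$ are independent and identically distributed with probability $(b^j-b+1)b^{-j}$ to equal $d$ and probability $b^{-j}$ to equal any given $a\ne d$. Define $$F_j(b,d)=\int_{[b^{-1},1)}\frac{d\nu_j(x)}{x^j},\qquad F_j^*(b,d)=\int_{[b^{-1},1)\setminus[db^{-1},(d+1)b^{-1})}\frac{d\nu_j(x)}{x^j}.$$ Let $Q=(q_{ij})_{i,j\ge1}$ be the infinite unipotent upper-triangular matrix with $q_{ij}=0$ for $j<i$ and $q_{ij}=(-1)^{j-i}\binom{j-1}{i-1}\int_{[0,1)}(d+x)^{j-i}\,d\nu_i(x)$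 for $j\ge i$. Then $c_j(b,d)$ is the $j$-th entry of the first row of $Q^{-1}$: $c_j(b,d)=(Q^{-1})_{1,j}$. *)

theory Defs
  imports "HOL-Probability.Probability"
begin

(* b ^ i \<le> n says that position i lies within the representation of n without leading zeros. *)
definition digit_count :: "nat \<Rightarrow> nat \<Rightarrow> nat \<Rightarrow> nat" where
  "digit_count b d n = card {i. b ^ i \<le> n \<and> n div b ^ i mod b = d}"

definition irwin_set :: "nat \<Rightarrow> nat \<Rightarrow> nat \<Rightarrow> nat set" where
  "irwin_set b d k = {n. n > 0 \<and> digit_count b d n = k}"

definition irwin_sum :: "nat \<Rightarrow> nat \<Rightarrow> nat \<Rightarrow> real" where
  "irwin_sum b d k = (\<Sum>\<^sub>\<infinity>n\<in>irwin_set b d k. 1 / real n)"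

definition lam :: "nat \<Rightarrow> nat \<Rightarrow> real" where
  "lam b j = 1 / (real b ^ j - real b + 1)"

definition digit_pmf :: "nat \<Rightarrow> nat \<Rightarrow> nat \<Rightarrow> nat pmf" where
  "digit_pmf b d j = embed_pmf (\<lambda>a.
     if a = d then (real b ^ j - real b + 1) / real b ^ j
     else if a < b then 1 / real b ^ j
     else 0)"

(* Coordinate i of the product space, i = 0, 1, ..., is the digit with weight b ^ -(i + 1). *)
definition nu :: "nat \<Rightarrow> nat \<Rightarrow> nat \<Rightarrow> real measure" where
  "nu b d j = distr (\<Pi>\<^sub>M i\<in>(UNIV :: nat set). measure_pmf (digit_pmf b d j)) borel
     (\<lambda>\<omega>. \<Sum>i. real (\<omega> i) / real b ^ Suc i)"

definition F :: "nat \<Rightarrow> nat \<Rightarrow> nat \<Rightarrow> real" where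
  "F b d j = (LINT x:{1 / real b..<1}|nu b d j. 1 / x ^ j)"

definition F_star :: "nat \<Rightarrow> nat \<Rightarrow> nat \<Rightarrow> real" where
  "F_star b d j =
     (LINT x:{1 / real b..<1} - {real d / real b..<(real d + 1) / real b}|nu b d j. 1 / x ^ j)"

(* Infinite upper-triangular matrices indexed by {1, 2, ...} are functions on pairs that
   vanish outside 1 \<le> i \<le> j. Since B is upper triangular in column j, the
   finite sum in ut_mult is the whole matrix product. *)
definition ut_matrix :: "(nat \<Rightarrow> nat \<Rightarrow> real) \<Rightarrow> bool" where
  "ut_matrix A \<longleftrightarrow> (\<forall>i j. \<not> (1 \<le> i \<and> i \<le> j) \<longrightarrow> A i j = 0)"

definition ut_mult :: "(nat \<Rightarrow> nat \<Rightarrow> real) \<Rightarrow> (nat \<Rightarrow> nat \<Rightarrow> real) \<Rightarrow> nat \<Rightarrow> nat \<Rightarrow> real" where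
  "ut_mult A B i j = (\<Sum>k=1..j. A i k * B k j)"

definition ut_id :: "nat \<Rightarrow> nat \<Rightarrow> real" where
  "ut_id i j = (if 1 \<le> i \<and> i = j then 1 else 0)"

definition ut_inverse :: "(nat \<Rightarrow> nat \<Rightarrow> real) \<Rightarrow> nat \<Rightarrow> nat \<Rightarrow> real" where
  "ut_inverse A = (THE B. ut_matrix B \<and> ut_mult A B = ut_id \<and> ut_mult B A = ut_id)"

definition Q :: "nat \<Rightarrow> nat \<Rightarrow> nat \<Rightarrow> nat \<Rightarrow> real" where
  "Q b d i j =
     (if 1 \<le> i \<and> i \<le> j
      then (-1) ^ (j - i) * real ((j - 1) choose (i - 1)) *
           (LINT x:{0..<1}|nu b d i. (real d + x) ^ (j - i))
      else 0)"

definition c :: "nat \<Rightarrow> nat \<Rightarrow> nat \<Rightarrow> real" where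
  "c b d j = ut_inverse (Q b d) 1 j"


(* The argument of embed_pmf in digit_pmf is a probability mass function. *)
lemma pmf_digit_pmf:
  assumes b: "b > 1" and d: "d < b" and j: "j \<ge> 1"
  shows "pmf (digit_pmf b d j) a =
    (if a = d then (real b ^ j - real b + 1) / real b ^ j
     else if a < b then 1 / real b ^ j else 0)"
proof -
  let ?f = "\<lambda>a. if a = d then (real b ^ j - real b + 1) / real b ^ j
     else if a < b then 1 / real b ^ j else 0"
  have le: "real b \<le> real b ^ j"
    using b j self_le_power[of "real b" j] by simp
  have nn: "0 \<le> ?f x" for x
    using b le by auto
  have "(\<Sum>x<b. ?f x) = ?f d + (\<Sum>x\<in>{..<b} - {d}. ?f x)"
    using d by (subst sum.remove[of _ d]) auto
  also have "(\<Sum>x\<in>{..<b} - {d}. ?f x) = (\<Sum>x\<in>{..<b} - {d}. 1 / real b ^ j)"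
    by (rule sum.cong) auto
  also have "\<dots> = (real b - 1) / real b ^ j"
    using b d by (simp add: of_nat_diff)
  finally have s: "(\<Sum>x<b. ?f x) = 1"
    using b by (simp add: field_simps)
  have "(\<integral>\<^sup>+x. ennreal (?f x) \<partial>count_space UNIV) = (\<Sum>x<b. ennreal (?f x))"
    using d by (intro nn_integral_count_space') (auto split: if_splits)
  also have "\<dots> = ennreal (\<Sum>x<b. ?f x)"
    by (rule sum_ennreal) (rule nn)
  finally have "(\<integral>\<^sup>+x. ennreal (?f x) \<partial>count_space UNIV) = 1"
    using s by simp
  then show ?thesis
    unfolding digit_pmf_def by (rule pmf_embed_pmf[OF nn])
qed

lemma prob_space_nu: "prob_space (nu b d j)"
proof -
  let ?P = "\<lambda>_::nat. measure_pmf (digit_pmf b d j)"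
  have "(\<lambda>\<omega>. \<Sum>i. real (\<omega> i) / real b ^ Suc i) \<in> borel_measurable (Pi\<^sub>M UNIV ?P)"
    by measurable
  then show ?thesis
    unfolding nu_def
    by (intro prob_space.prob_space_distr prob_space_PiM prob_space_measure_pmf)
qed

(* nu b d j is concentrated on [0, 1): almost surely some digit differs from b - 1. *)
lemma AE_nu_in_unit:
  assumes b: "b > 1" and d: "d < b" and j: "j \<ge> 1"
  shows "AE x in nu b d j. x \<in> {0..<1}"
proof -
  let ?D = "digit_pmf b d j"
  let ?P = "\<lambda>_::nat. measure_pmf ?D"
  let ?X = "\<lambda>\<omega>. \<Sum>i. real (\<omega> i) / real b ^ Suc i"
  interpret product_prob_space ?P UNIV
    by unfold_locales
  have X: "?X \<in> borel_measurable (Pi\<^sub>M UNIV ?P)"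
    by measurable
  note pmf = pmf_digit_pmf[OF b d j]
  have "AE a in measure_pmf ?D. a < b"
    using d by (auto simp: AE_measure_pmf_iff set_pmf_iff pmf split: if_splits)
  then have "AE \<omega> in Pi\<^sub>M UNIV ?P. \<omega> i < b" for i
    by (intro AE_PiM_component) (auto intro: prob_space_measure_pmf)
  then have lt: "AE \<omega> in Pi\<^sub>M UNIV ?P. \<forall>i. \<omega> i < b"
    by (simp add: AE_all_countable)
  define p where "p = pmf ?D (b - 1)"
  define y where "y = real b ^ j"
  have y: "real b \<le> y"
    unfolding y_def using b j self_le_power[of "real b" j] by simp
  then have p: "0 \<le> p" "p < 1"
    unfolding p_def using b by (auto simp: pmf field_simps simp flip: y_def)
  define N where "N = {\<omega> :: nat \<Rightarrow> nat. \<forall>i. \<omega> i = b - 1}"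
  have N: "N \<in> sets (Pi\<^sub>M UNIV ?P)"
    unfolding N_def 
  proof -
    have "{\<omega>\<in>space (Pi\<^sub>M UNIV ?P). \<forall>i. \<omega> i = b - 1} \<in> sets (Pi\<^sub>M UNIV ?P)"
      by measurable
    then show "{\<omega> :: nat \<Rightarrow> nat. \<forall>i. \<omega> i = b - 1} \<in> sets (Pi\<^sub>M UNIV ?P)"
      by (simp add: space_PiM)
  qed
  have "emeasure (Pi\<^sub>M UNIV ?P) N \<le> ennreal (p ^ n)" for n
  proof -
    have "emeasure (Pi\<^sub>M UNIV ?P) N \<le>
        emeasure (Pi\<^sub>M UNIV ?P) {\<omega>\<in>space (Pi\<^sub>M UNIV ?P). \<forall>i\<in>{..<n}. \<omega> i \<in> {b - 1}}"
    proof (rule emeasure_mono)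
      have "{\<omega>\<in>space (Pi\<^sub>M UNIV ?P). \<forall>i\<in>{..<n}. \<omega> i = b - 1} \<in> sets (Pi\<^sub>M UNIV ?P)"
        by measurable
      then show "{\<omega>\<in>space (Pi\<^sub>M UNIV ?P). \<forall>i\<in>{..<n}. \<omega> i \<in> {b - 1}} \<in> sets (Pi\<^sub>M UNIV ?P)"
        by simp
    qed (auto simp: N_def space_PiM)
    also have "\<dots> = (\<Prod>i\<in>{..<n}. emeasure (measure_pmf ?D) {b - 1})"
      by (rule emeasure_PiM_Collect) auto
    also have "\<dots> = ennreal (p ^ n)"
      using p by (simp add: emeasure_pmf_single p_def ennreal_power)
    finally show ?thesis .
  qed
  moreover have "(\<lambda>n. ennreal (p ^ n)) \<longlonglongrightarrow> ennreal 0"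
    using p by (intro tendsto_ennrealI LIMSEQ_realpow_zero) auto
  ultimately have "emeasure (Pi\<^sub>M UNIV ?P) N \<le> ennreal 0"
    by (intro tendsto_lowerbound[of "\<lambda>n. ennreal (p ^ n)" _ sequentially]) auto
  then have "N \<in> null_sets (Pi\<^sub>M UNIV ?P)"
    using N by auto
  then have ne: "AE \<omega> in Pi\<^sub>M UNIV ?P. \<omega> \<notin> N"
    by (rule AE_not_in)
  have "AE \<omega> in Pi\<^sub>M UNIV ?P. ?X \<omega> \<in> {0..<1}"
    using lt ne
  proof eventually_elim
    case (elim \<omega>)
    let ?g = "\<lambda>i. (real b - 1) / real b ^ Suc i"
    have "(\<lambda>i. (real b - 1) / real b * (1 / real b) ^ i) sums
        ((real b - 1) / real b * (1 / (1 - 1 / real b)))"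
      using b by (intro sums_mult geometric_sums) auto
    then have g: "?g sums 1"
      using b by (simp add: power_divide field_simps)
    have le: "real (\<omega> i) / real b ^ Suc i \<le> ?g i" for i
    proof (rule divide_right_mono)
      show "real (\<omega> i) \<le> real b - 1"
        using elim(1)[rule_format, of i] by linarith
    qed auto
    have sm: "summable (\<lambda>i. real (\<omega> i) / real b ^ Suc i)"
      by (rule summable_comparison_test'[OF sums_summable[OF g], of 0]) (use le in auto)
    obtain m where "\<omega> m \<noteq> b - 1"
      using elim(2) unfolding N_def by auto
    then have "real (\<omega> m) < real b - 1"
      using elim(1)[rule_format, of m] by linarith
    then have m: "0 < ?g m - real (\<omega> m) / real b ^ Suc m"
      using b by (simp add: divide_strict_right_mono)
    have "0 < (\<Sum>i. ?g i - real (\<omega> i) / real b ^ Suc i)"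
      by (rule suminf_pos2[OF summable_diff[OF sums_summable[OF g] sm] _ m]) (use le in simp)
    also have "\<dots> = 1 - ?X \<omega>"
      using suminf_diff[OF sums_summable[OF g] sm] sums_unique[OF g] by simp
    finally have "?X \<omega> < 1"
      by simp
    moreover have "0 \<le> ?X \<omega>"
      by (rule suminf_nonneg[OF sm]) simp
    ultimately show ?case
      by simp
  qed
  then show ?thesis
    unfolding nu_def by (subst AE_distr_iff[OF X]) auto
qed


(* A unipotent upper-triangular matrix has exactly one inverse, so the THE in ut_inverse is
   well defined at Q. *)
lemma ut_mult_mono:
  assumes "ut_matrix B" "j \<le> n"
  shows "ut_mult A B i j = (\<Sum>k=1..n. A i k * B k j)"
  unfolding ut_mult_def
  using assms by (intro sum.mono_neutral_left) (auto simp: ut_matrix_def)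

lemma ut_mult_assoc:
  assumes "ut_matrix B" "ut_matrix C"
  shows "ut_mult (ut_mult A B) C = ut_mult A (ut_mult B C)"
proof (intro ext)
  fix i j
  have "ut_mult (ut_mult A B) C i j = (\<Sum>k=1..j. (\<Sum>l=1..j. A i l * B l k) * C k j)"
    unfolding ut_mult_def[of _ C] by (intro sum.cong refl) (simp add: ut_mult_mono[OF assms(1), where n = j])
  also have "\<dots> = (\<Sum>l=1..j. \<Sum>k=1..j. A i l * B l k * C k j)"
    by (subst sum.swap) (simp add: sum_distrib_right)
  also have "\<dots> = ut_mult A (ut_mult B C) i j"
    by (simp add: ut_mult_def sum_distrib_left mult.assoc)
  finally show "ut_mult (ut_mult A B) C i j = ut_mult A (ut_mult B C) i j" .
qed

lemma ut_mult_id_left: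
  assumes "ut_matrix A"
  shows "ut_mult ut_id A = A"
proof (intro ext)
  fix i j
  have "ut_mult ut_id A i j = (\<Sum>k=1..j. if i = k then A k j else 0)"
    unfolding ut_mult_def by (intro sum.cong) (auto simp: ut_id_def)
  also have "\<dots> = A i j"
    using assms by (auto simp: ut_matrix_def)
  finally show "ut_mult ut_id A i j = A i j" .
qed

lemma ut_mult_id_right:
  assumes "ut_matrix A"
  shows "ut_mult A ut_id = A"
proof (intro ext)
  fix i j
  have "ut_mult A ut_id i j = (\<Sum>k=1..j. if k = j then A i k else 0)"
    unfolding ut_mult_def by (intro sum.cong) (auto simp: ut_id_def)
  also have "\<dots> = A i j"
    using assms by (auto simp: ut_matrix_def)
  finally show "ut_mult A ut_id i j = A i j" .
qed

fun ut_left_inverse :: "(nat \<Rightarrow> nat \<Rightarrow> real) \<Rightarrow> nat \<Rightarrow> nat \<Rightarrow> real" where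
  "ut_left_inverse A i j =
     ut_id i j - (\<Sum>k\<leftarrow>[1..<j]. ut_left_inverse A i k * A k j)"

declare ut_left_inverse.simps [simp del]

lemma ut_left_inverse_eq:
  "ut_left_inverse A i j = ut_id i j - (\<Sum>k=1..<j. ut_left_inverse A i k * A k j)"
  by (subst ut_left_inverse.simps) (simp add: interv_sum_list_conv_sum_set_nat)

lemma ut_left_inverse:
  assumes A: "ut_matrix A" and diag: "\<And>i. 1 \<le> i \<Longrightarrow> A i i = 1"
  shows "ut_matrix (ut_left_inverse A)"
    and "1 \<le> i \<Longrightarrow> ut_left_inverse A i i = 1"
    and "ut_mult (ut_left_inverse A) A = ut_id"
proof -
  have z: "ut_left_inverse A i j = 0" if "\<not> (1 \<le> i \<and> i \<le> j)" for i j
    using that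
  proof (induction j rule: less_induct)
    case (less j)
    have "(\<Sum>k=1..<j. ut_left_inverse A i k * A k j) = 0"
      by (rule sum.neutral) (use less in auto)
    then show ?case
      using less.prems by (subst ut_left_inverse_eq) (auto simp: ut_id_def)
  qed
  then show ut: "ut_matrix (ut_left_inverse A)"
    by (auto simp: ut_matrix_def)
  show "ut_left_inverse A i i = 1" if "1 \<le> i" for i
  proof -
    have "(\<Sum>k=1..<i. ut_left_inverse A i k * A k i) = 0"
      by (rule sum.neutral) (auto simp: z)
    then show ?thesis
      using that by (subst ut_left_inverse_eq) (simp add: ut_id_def)
  qed
  show "ut_mult (ut_left_inverse A) A = ut_id"
  proof (intro ext)
    fix i j
    show "ut_mult (ut_left_inverse A) A i j = ut_id i j"
    proof (cases "j = 0")
      case False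
      then have "{1..j} = insert j {1..<j}"
        by auto
      then have "ut_mult (ut_left_inverse A) A i j =
          ut_left_inverse A i j * A j j + (\<Sum>k=1..<j. ut_left_inverse A i k * A k j)"
        unfolding ut_mult_def by simp
      also have "\<dots> = ut_id i j"
        using diag[of j] False ut_left_inverse_eq[of A i j] by simp
      finally show ?thesis .
    qed (auto simp: ut_mult_def ut_id_def)
  qed
qed

lemma ut_inverse_exists_unique:
  assumes A: "ut_matrix A" and diag: "\<And>i. 1 \<le> i \<Longrightarrow> A i i = 1"
  shows "\<exists>!B. ut_matrix B \<and> ut_mult A B = ut_id \<and> ut_mult B A = ut_id"
proof (rule ex1I)
  define B where "B = ut_left_inverse A"
  define C where "C = ut_left_inverse B"
  note B = ut_left_inverse[OF A diag, folded B_def]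
  note C = ut_left_inverse[OF B(1,2), folded C_def]
  have "C = ut_mult C (ut_mult B A)"
    using B(3) C(1) by (simp add: ut_mult_id_right)
  also have "\<dots> = A"
    using C(3) A B(1) by (simp add: ut_mult_assoc[symmetric] ut_mult_id_left)
  finally show *: "ut_matrix B \<and> ut_mult A B = ut_id \<and> ut_mult B A = ut_id"
    using B(1,3) C(3) by simp
  fix B' assume B': "ut_matrix B' \<and> ut_mult A B' = ut_id \<and> ut_mult B' A = ut_id"
  have "B' = ut_mult (ut_mult B A) B'"
    using B' B(3) by (simp add: ut_mult_id_left)
  also have "\<dots> = B"
    using B' A B(1) by (simp add: ut_mult_assoc ut_mult_id_right)
  finally show "B' = B" .
qed

lemma ut_matrix_Q: "ut_matrix (Q b d)"
  unfolding ut_matrix_def Q_def by auto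

lemma Q_unipotent:
  assumes i: "1 \<le> i" and b: "b > 1" and d: "d < b"
  shows "Q b d i i = 1"
proof -
  interpret prob_space "nu b d i"
    by (rule prob_space_nu)
  have "(LINT x:{0..<1}|nu b d i. (1::real)) = (LINT x|nu b d i. 1)"
    unfolding set_lebesgue_integral_def
  proof (rule integral_cong_AE)
    show "AE x in nu b d i. indicator {0..<1} x *\<^sub>R (1::real) = 1"
      using AE_nu_in_unit[OF b d i] by eventually_elim simp
  qed (auto simp: nu_def)
  also have "\<dots> = 1"
    by (simp add: prob_space)
  finally show ?thesis
    using i by (simp add: Q_def)
qed

lemma ut_inverse_Q:
  assumes "b > 1" "d < b"
  shows "ut_matrix (ut_inverse (Q b d)) \<and>
    ut_mult (Q b d) (ut_inverse (Q b d)) = ut_id \<and>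
    ut_mult (ut_inverse (Q b d)) (Q b d) = ut_id"
proof -
  have "\<exists>!B. ut_matrix B \<and> ut_mult (Q b d) B = ut_id \<and> ut_mult B (Q b d) = ut_id"
    by (intro ut_inverse_exists_unique ut_matrix_Q Q_unipotent assms)
  from theI'[OF this] show ?thesis
    by (simp add: ut_inverse_def)
qed

end

theory Submission
  imports Defs
begin

text \<open>
  For each \<open>n\<close>, the coefficients \<open>c j\<close> give the expansion of \<open>1 / (b n)\<close> as the series of
  \<open>c j\<close> times the \<open>nu b d j\<close>-integral of \<open>1 / (b n + d + x) ^ j\<close>: by its definition, the inverse
  matrix turns the derivatives of a polynomial integrated against the measures \<open>nu b d j\<close> into the
  value at \<open>- d\<close>, and \<open>c j\<close> grows slowly enough for this to extend to \<open>x \<mapsto> 1 / (b n + d + x)\<close>,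
  because \<open>nu b d j\<close> concentrates near \<open>d / (b - 1)\<close> up to a mass of order \<open>b ^ (- j)\<close>.
  Summing over all \<open>n\<close> with \<open>k\<close> digits \<open>d\<close> gives the sum of the \<open>1 / (b n)\<close> on one side. On the other,
  the self-similarity of \<open>nu b d j\<close> yields a recursion in \<open>k\<close> whose solution is
  \<open>F b d j * lam b j ^ (k + 1)\<close>.
\<close>

section \<open>Self-similarity of the digit measures\<close>

text \<open>Prepending an independent digit \<open>a\<close> to an i.i.d. sequence gives an i.i.d.
  sequence of the same law (\<open>PiM_iter\<close>); on the represented numbers this is x \<mapsto>
  (a + x) / b.\<close>

lemma nu_self_similar:
  assumes b: "b > 1" and d: "d < b" and j: "j \<ge> 1"
  shows "nu b d j = distr (measure_pmf (digit_pmf b d j) \<Otimes>\<^sub>M nu b d j) borel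
    (\<lambda>(a, x). (real a + x) / real b)"
proof -
  let ?D = "measure_pmf (digit_pmf b d j)"
  let ?X = "\<lambda>\<omega>::nat \<Rightarrow> nat. \<Sum>i. real (\<omega> i) / real b ^ Suc i"
  interpret sequence_space ?D by unfold_locales
  have X [measurable]: "?X \<in> borel_measurable S"
    by measurable
  have nu: "nu b d j = distr S borel ?X"
    by (simp add: nu_def)
  let ?c = "\<lambda>(s, \<omega>). case_nat s \<omega> :: nat \<Rightarrow> nat"
  have cm: "?c \<in> measurable (?D \<Otimes>\<^sub>M S) S"
    by measurable
  \<comment> \<open>The shift by one digit needs a convergent series, so the identity is shown where
    all digits are below \<open>b\<close>, which is almost everywhere.\<close>
  have "AE a in ?D. a < b"
    using d by (auto simp: AE_measure_pmf_iff set_pmf_iff pmf_digit_pmf[OF b d j] split: if_splits)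
  then have "AE \<omega> in S. \<omega> i < b" for i
    by (intro AE_PiM_component) (auto intro: prob_space_measure_pmf)
  then have lt: "AE \<omega> in S. \<forall>i. \<omega> i < b"
    by (simp add: AE_all_countable)
  have AE: "AE p in ?D \<Otimes>\<^sub>M S. \<forall>i. ?c p i < b"
    by (rule AE_distrD[OF cm], subst PiM_iter) (rule lt)
  have "nu b d j = distr (distr (?D \<Otimes>\<^sub>M S) S ?c) borel ?X"
    by (simp add: nu PiM_iter)
  also have "\<dots> = distr (?D \<Otimes>\<^sub>M S) borel (?X \<circ> ?c)"
    by (rule distr_distr) (use cm in measurable)
  also have "\<dots> = distr (?D \<Otimes>\<^sub>M S) borel ((\<lambda>(a, x). (real a + x) / real b) \<circ> (\<lambda>(a, \<omega>). (a, ?X \<omega>)))"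
  proof (rule distr_cong_AE)
    show "AE p in ?D \<Otimes>\<^sub>M S. (?X \<circ> ?c) p =
        ((\<lambda>(a, x). (real a + x) / real b) \<circ> (\<lambda>(a, \<omega>). (a, ?X \<omega>))) p"
      using AE
    proof eventually_elim
      case (elim p)
      obtain a \<omega> where p: "p = (a, \<omega>)" by fastforce
      have \<omega>: "\<omega> i < b" for i
        using elim[rule_format, of "Suc i"] by (simp add: p)
      have sm: "summable (\<lambda>i. real (\<omega> i) / real b ^ Suc i)"
      proof (rule summable_comparison_test'[of "\<lambda>i. (1 / real b) ^ i" 0])
        show "summable (\<lambda>i. (1 / real b) ^ i)"
          using b by (intro summable_geometric) auto
        show "norm (real (\<omega> n) / real b ^ Suc n) \<le> (1 / real b) ^ n" for n
          using \<omega>[of n] b by (simp add: power_divide field_simps)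
      qed
      have "(\<lambda>i. real (case_nat a \<omega> (Suc i)) / real b ^ Suc (Suc i)) sums (?X \<omega> / real b)"
        using sums_divide[OF summable_sums[OF sm], of "real b"] by (simp add: field_simps)
      then have "(\<lambda>i. real (case_nat a \<omega> i) / real b ^ Suc i) sums (?X \<omega> / real b + real a / real b)"
        using sums_Suc[of "\<lambda>i. real (case_nat a \<omega> i) / real b ^ Suc i"] by simp
      then show ?case
        using p by (simp add: sums_unique[symmetric] add_divide_distrib add.commute)
    qed
  qed (use cm in measurable)
  also have "\<dots> = distr (distr (?D \<Otimes>\<^sub>M S) (?D \<Otimes>\<^sub>M borel) (\<lambda>(a, \<omega>). (a, ?X \<omega>))) borel
      (\<lambda>(a, x). (real a + x) / real b)"
    by (rule distr_distr[symmetric]) measurable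
  also have "distr (?D \<Otimes>\<^sub>M S) (?D \<Otimes>\<^sub>M borel) (\<lambda>(a, \<omega>). (a, ?X \<omega>)) = ?D \<Otimes>\<^sub>M nu b d j"
    using pair_measure_distr[of "\<lambda>a. a" ?D ?D ?X S borel]
    by (simp add: nu prob_space_distr prob_space_imp_sigma_finite)
  finally show ?thesis .
qed

subsection \<open>Interchange of sums and a binomial series\<close>

lemma infsum_sum_swap:
  fixes f :: "'b \<Rightarrow> 'a \<Rightarrow> real"
  assumes "finite B" "\<And>y. y \<in> B \<Longrightarrow> f y summable_on A"
  shows "(\<Sum>\<^sub>\<infinity>x\<in>A. \<Sum>y\<in>B. f y x) = (\<Sum>y\<in>B. \<Sum>\<^sub>\<infinity>x\<in>A. f y x)"
proof -
  have "((\<lambda>x. \<Sum>y\<in>B. f y x) has_sum (\<Sum>y\<in>B. \<Sum>\<^sub>\<infinity>x\<in>A. f y x)) A"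
    using assms by (induction rule: finite_induct) (auto intro!: has_sum_add has_sum_infsum)
  then show ?thesis by (rule infsumI)
qed

text \<open>Fubini between an unordered sum and a series: the majorant \<open>g\<close> makes the
  family absolutely summable on the product, so the swapped series converges absolutely too.\<close>

lemma sums_infsum_swap:
  fixes f :: "'a \<Rightarrow> nat \<Rightarrow> real"
  assumes sm: "\<And>a. a \<in> A \<Longrightarrow> summable (\<lambda>j. \<bar>f a j\<bar>)"
    and le: "\<And>a. a \<in> A \<Longrightarrow> (\<Sum>j. \<bar>f a j\<bar>) \<le> g a"
    and g: "g summable_on A"
  shows "summable (\<lambda>j. \<bar>\<Sum>\<^sub>\<infinity>a\<in>A. f a j\<bar>)"
    and "(\<lambda>j. \<Sum>\<^sub>\<infinity>a\<in>A. f a j) sums (\<Sum>\<^sub>\<infinity>a\<in>A. \<Sum>j. f a j)"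
proof -
  have abs: "(\<lambda>j. norm (f a j)) summable_on UNIV" if "a \<in> A" for a
    using sm[OF that] by (simp add: summable_on_UNIV_nonneg_real_iff)
  have eq: "(\<Sum>\<^sub>\<infinity>j. norm (f a j)) = (\<Sum>j. \<bar>f a j\<bar>)" if "a \<in> A" for a
    using sums_unique[OF has_sum_imp_sums[OF has_sum_infsum[OF abs[OF that]]]] by simp
  have "(\<lambda>a. norm (\<Sum>\<^sub>\<infinity>j. norm (f a j))) summable_on A"
  proof (rule Infinite_Sum.abs_summable_on_comparison_test)
    show "(\<lambda>a. norm (g a)) summable_on A"
      using g summable_on_iff_abs_summable_on_real by auto
    show "norm (\<Sum>\<^sub>\<infinity>j. norm (f a j)) \<le> norm (g a)" if "a \<in> A" for a
      using le[OF that] suminf_nonneg[OF sm[OF that]] eq[OF that] by simp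
  qed
  then have Sig: "(\<lambda>p. norm (case p of (a, j) \<Rightarrow> f a j)) summable_on A \<times> UNIV"
    using abs by (subst Infinite_Sum.abs_summable_on_Sigma_iff) auto
  have "(\<lambda>p. norm (case p of (j, a) \<Rightarrow> f a j)) summable_on UNIV \<times> A"
    using Sig
    by (subst summable_on_reindex_bij_witness[of _ prod.swap prod.swap "A \<times> UNIV"
          "\<lambda>p. norm (case p of (a, j) \<Rightarrow> f a j)"]) auto
  then have inner: "(\<lambda>a. norm (f a j)) summable_on A"
    and outer: "(\<lambda>j. norm (\<Sum>\<^sub>\<infinity>a\<in>A. norm (f a j))) summable_on UNIV" for j
    using Infinite_Sum.abs_summable_on_Sigma_iff[of "\<lambda>(j, a). f a j" UNIV "\<lambda>_. A"] by auto
  have bound: "norm (\<Sum>\<^sub>\<infinity>a\<in>A. f a j) \<le> norm (\<Sum>\<^sub>\<infinity>a\<in>A. norm (f a j))" for j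
    using Infinite_Sum.norm_infsum_bound[OF inner[of j]] by simp
  have out: "(\<lambda>j. norm (\<Sum>\<^sub>\<infinity>a\<in>A. f a j)) summable_on UNIV"
    by (rule Infinite_Sum.abs_summable_on_comparison_test[OF outer bound])
  then show "summable (\<lambda>j. \<bar>\<Sum>\<^sub>\<infinity>a\<in>A. f a j\<bar>)"
    by (simp add: summable_on_UNIV_nonneg_real_iff)
  have "(\<Sum>\<^sub>\<infinity>a\<in>A. \<Sum>j. f a j) = (\<Sum>\<^sub>\<infinity>a\<in>A. \<Sum>\<^sub>\<infinity>j. f a j)"
    using sums_unique[OF has_sum_imp_sums[OF has_sum_infsum[OF Infinite_Sum.abs_summable_summable[OF abs]]], symmetric]
    by (intro infsum_cong) simp
  also have "\<dots> = (\<Sum>\<^sub>\<infinity>j. \<Sum>\<^sub>\<infinity>a\<in>A. f a j)"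
    by (rule infsum_swap_banach) (rule Infinite_Sum.abs_summable_summable[OF Sig])
  finally show "(\<lambda>j. \<Sum>\<^sub>\<infinity>a\<in>A. f a j) sums (\<Sum>\<^sub>\<infinity>a\<in>A. \<Sum>j. f a j)"
    using has_sum_infsum[OF Infinite_Sum.abs_summable_summable[OF out]] by (simp add: has_sum_imp_sums)
qed

text \<open>The geometric series of 1 / (w - y), differentiated \<open>j\<close> times in
  \<open>y\<close> and divided by j!, obtained from the binomial series with exponent -(j + 1). For
  m < j the binomial vanishes, so the truncated \<open>m - j\<close> is harmless.\<close>

lemma neg_binomial_sums:
  fixes y w :: real
  assumes "0 \<le> y" "y < w"
  shows "(\<lambda>m. real (m choose j) * y ^ (m - j) / w ^ Suc m) sums (1 / (w - y) ^ Suc j)"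
proof -
  have w: "w > 0" using assms by simp
  have "\<bar>- (y / w)\<bar> < 1" using assms by (simp add: field_simps)
  from gen_binomial_real[OF this, of "- real (Suc j)"]
  have "(\<lambda>n. (- real (Suc j) gchoose n) * (- (y / w)) ^ n) sums (1 - y / w) powr (- real (Suc j))"
    by simp
  also have "(\<lambda>n. (- real (Suc j) gchoose n) * (- (y / w)) ^ n) = (\<lambda>n. real (n + j choose j) * (y / w) ^ n)"
  proof
    fix n
    have "(- real (Suc j) gchoose n) = (- 1) ^ n * real (n + j choose n)"
    proof -
      have "real n - (- real (Suc j)) - 1 = real (n + j)" by simp
      then show ?thesis
        by (simp only: gbinomial_negated_upper[of "- real (Suc j)"] binomial_gbinomial)
    qed
    also have "n + j choose n = n + j choose j"
      by (subst binomial_symmetric) auto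
    finally have "(- real (Suc j) gchoose n) * (- (y / w)) ^ n =
        real (n + j choose j) * ((- 1) ^ n * (- (y / w)) ^ n)"
      by (simp only: mult_ac)
    also have "(- 1) ^ n * (- (y / w)) ^ n = (y / w) ^ n"
      by (simp flip: power_mult_distrib)
    finally show "(- real (Suc j) gchoose n) * (- (y / w)) ^ n = real (n + j choose j) * (y / w) ^ n" .
  qed
  also have "(1 - y / w) powr (- real (Suc j)) = 1 / (1 - y / w) ^ Suc j"
    using assms w by (subst powr_minus_divide, subst powr_realpow) (auto simp: field_simps)
  finally have "(\<lambda>n. real (n + j choose j) * (y / w) ^ n / w ^ Suc j) sums (1 / (1 - y / w) ^ Suc j / w ^ Suc j)"
    by (rule sums_divide)
  also have "(\<lambda>n. real (n + j choose j) * (y / w) ^ n / w ^ Suc j) =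
      (\<lambda>n. real (n + j choose j) * y ^ (n + j - j) / w ^ Suc (n + j))"
    by (simp add: fun_eq_iff power_divide power_add mult_ac)
  also have "1 / (1 - y / w) ^ Suc j / w ^ Suc j = 1 / ((1 - y / w) * w) ^ Suc j"
    by (simp only: power_mult_distrib divide_divide_eq_left)
  also have "(1 - y / w) * w = w - y" using w by (simp add: field_simps)
  finally show ?thesis
    using sums_zero_iff_shift[of j "\<lambda>m. real (m choose j) * y ^ (m - j) / w ^ Suc m"] by simp
qed

subsection \<open>Appending a digit\<close>

text \<open>Appending moves every position of \<open>m\<close> up by one and puts \<open>a\<close>
  at position 0.\<close>

lemma digit_count_append:
  assumes b: "b > 1" and m: "m > 0" and a: "a < b"
  shows "digit_count b d (b * m + a) = digit_count b d m + (if a = d then 1 else 0)"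
proof -
  let ?S = "{i. b ^ i \<le> m \<and> m div b ^ i mod b = d}"
  have "finite {i. b ^ i \<le> m}"
  proof (rule finite_subset)
    have "i \<le> m" if "b ^ i \<le> m" for i
    proof -
      have "i < b ^ i" by (rule power_gt_expt) (use b in simp)
      then show ?thesis using that by linarith
    qed
    then show "{i. b ^ i \<le> m} \<subseteq> {..m}"
      by blast
  qed auto
  then have fin: "finite ?S" by (rule rev_finite_subset) auto
  have div: "(b * m + a) div b ^ Suc i = m div b ^ i" for i
    using a by (simp add: div_mult2_eq)
  have le: "b ^ Suc i \<le> b * m + a \<longleftrightarrow> b ^ i \<le> m" for i
  proof -
    have "b ^ Suc i \<le> b * m + a \<longleftrightarrow> (b * m + a) div b ^ Suc i \<noteq> 0"
      using b by (simp add: div_eq_0_iff not_less del: power_Suc)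
    also have "\<dots> \<longleftrightarrow> b ^ i \<le> m"
      unfolding div using b by (simp add: div_eq_0_iff not_less)
    finally show ?thesis .
  qed
  have "{i. b ^ i \<le> b * m + a \<and> (b * m + a) div b ^ i mod b = d} =
      (if a = d then {0} else {}) \<union> Suc ` ?S" (is "?L = ?R")
  proof (rule set_eqI)
    fix i
    show "i \<in> ?L \<longleftrightarrow> i \<in> ?R"
    proof (cases i)
      case 0
      have "1 \<le> b * m + a" using b m by (simp add: Suc_le_eq)
      then show ?thesis using a 0 by auto
    next
      case (Suc k)
      then show ?thesis using div[of k] le[of k] by (auto simp del: power_Suc)
    qed
  qed
  then show ?thesis
    using fin by (simp add: digit_count_def card_insert_if card_image)
qed

lemma digit_count_single:
  assumes b: "b > 1" and a: "0 < a" "a < b"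
  shows "digit_count b d a = (if a = d then 1 else 0)"
proof -
  have eq: "b ^ i \<le> a \<longleftrightarrow> i = 0" for i
  proof (cases "i = 0")
    case False
    then have "b \<le> b ^ i" using b by (simp add: self_le_power)
    then show ?thesis using a(2) False by simp
  qed (use a in simp)
  have "{i. b ^ i \<le> a \<and> a div b ^ i mod b = d} = (if a = d then {0} else {})"
    unfolding eq using a by auto
  then show ?thesis by (simp add: digit_count_def)
qed

lemma bij_append_digit:
  fixes b :: nat
  assumes "b > 1"
  shows "bij_betw (\<lambda>(m, a). b * m + a) ({1..} \<times> {..<b}) {b..}"
proof (rule bij_betwI[where g = "\<lambda>n. (n div b, n mod b)"])
  show "(\<lambda>(m, a). b * m + a) \<in> {1..} \<times> {..<b} \<rightarrow> {b..}"
    by (auto intro: trans_le_add1)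
  show "(\<lambda>n. (n div b, n mod b)) \<in> {b..} \<rightarrow> {1..} \<times> {..<b}"
    using assms by (auto simp: Suc_le_eq div_greater_zero_iff)
qed (use assms in auto)

section \<open>Integration against the digit measures\<close>

context
  fixes b d :: nat
  assumes b: "b > 1" and d: "d < b"
begin

abbreviation E :: "nat \<Rightarrow> (real \<Rightarrow> real) \<Rightarrow> real" where
  "E j f \<equiv> LINT x|nu b d j. f x"

lemma measure_nu_space [simp]: "measure (nu b d j) (space (nu b d j)) = 1"
  by (rule prob_space.prob_space[OF prob_space_nu])

lemma sets_nu [measurable_cong, simp]: "sets (nu b d j) = sets borel"
  by (simp add: nu_def)

text \<open>The measure is concentrated on [0, 1), so a bound there suffices even for integrands
  such as 1 / (n + x) ^ j that are unbounded on the line.\<close>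

lemma integrable_nu:
  fixes f :: "real \<Rightarrow> real"
  assumes "j \<ge> 1" "f \<in> borel_measurable borel" "\<And>x. 0 \<le> x \<Longrightarrow> x < 1 \<Longrightarrow> \<bar>f x\<bar> \<le> B"
  shows "integrable (nu b d j) f"
proof -
  interpret prob_space "nu b d j" by (rule prob_space_nu)
  have "AE x in nu b d j. norm (f x) \<le> B"
    using AE_nu_in_unit[OF b d assms(1)] by eventually_elim (use assms(3) in auto)
  then show ?thesis
    by (rule integrable_const_bound) (use assms(2) in simp)
qed

lemma E_cong:
  assumes "j \<ge> 1" "f \<in> borel_measurable borel" "g \<in> borel_measurable borel"
    "\<And>x. 0 \<le> x \<Longrightarrow> x < 1 \<Longrightarrow> f x = g x"
  shows "E j f = E j g"
proof (rule integral_cong_AE)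
  show "AE x in nu b d j. f x = g x"
    using AE_nu_in_unit[OF b d assms(1)] by eventually_elim (use assms(4) in auto)
qed (use assms in auto)

lemma E_nonneg:
  assumes "j \<ge> 1" "\<And>x. 0 \<le> x \<Longrightarrow> x < 1 \<Longrightarrow> 0 \<le> f x"
  shows "0 \<le> E j f"
proof (rule integral_nonneg_AE)
  show "AE x in nu b d j. 0 \<le> f x"
    using AE_nu_in_unit[OF b d assms(1)] by eventually_elim (use assms(2) in auto)
qed

lemma E_mono:
  assumes "j \<ge> 1" "integrable (nu b d j) f" "integrable (nu b d j) g"
    "\<And>x. 0 \<le> x \<Longrightarrow> x < 1 \<Longrightarrow> f x \<le> g x"
  shows "E j f \<le> E j g"
proof (rule integral_mono_AE)
  show "AE x in nu b d j. f x \<le> g x"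
    using AE_nu_in_unit[OF b d assms(1)] by eventually_elim (use assms(4) in auto)
qed (use assms in auto)

text \<open>Conditioning on the first digit, by Fubini. The moment bounds and the identities for
  \<open>R\<close>, \<open>F\<close> and \<open>F_star\<close> all start from this formula.\<close>

lemma E_self_similar:
  assumes j: "j \<ge> 1" and f [measurable]: "f \<in> borel_measurable borel"
    and B: "\<And>x. 0 \<le> x \<Longrightarrow> x < 1 \<Longrightarrow> \<bar>f x\<bar> \<le> B"
  shows "E j f = (\<Sum>a<b. pmf (digit_pmf b d j) a * E j (\<lambda>x. f ((real a + x) / real b)))"
proof -
  let ?D = "measure_pmf (digit_pmf b d j)"
  let ?g = "\<lambda>(a, x). (real a + x) / real b"
  interpret nu: prob_space "nu b d j" by (rule prob_space_nu)
  interpret D: prob_space ?D by (rule prob_space_measure_pmf)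
  interpret pair_prob_space ?D "nu b d j" by unfold_locales
  have g [measurable]: "?g \<in> borel_measurable (?D \<Otimes>\<^sub>M nu b d j)"
    by measurable
  have int: "integrable (?D \<Otimes>\<^sub>M nu b d j) (\<lambda>p. f (?g p))"
    using integrable_nu[OF j f B] integrable_distr_eq[OF g f] nu_self_similar[OF b d j] by simp
  have D: "set_pmf (digit_pmf b d j) \<subseteq> {..<b}"
    using d by (auto simp: set_pmf_iff pmf_digit_pmf[OF b d j] split: if_splits)
  have "E j f = (LINT p|(?D \<Otimes>\<^sub>M nu b d j). f (?g p))"
    using integral_distr[OF g f] nu_self_similar[OF b d j] by simp
  also have "\<dots> = (LINT a|?D. LINT x|nu b d j. f ((real a + x) / real b))"
    using integral_fst'[OF int] by simp
  also have "\<dots> = (\<Sum>a<b. pmf (digit_pmf b d j) a * E j (\<lambda>x. f ((real a + x) / real b)))"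
    using D by (subst integral_measure_pmf[of "{..<b}"]) auto
  finally show ?thesis .
qed

subsection \<open>Moments of the digit measures\<close>

lemma digit_interval:
  fixes x :: real
  assumes "a < b" "0 \<le> x" "x < 1"
  shows "0 \<le> (real a + x) / real b" "(real a + x) / real b < 1"
  using assms b by (auto simp: field_simps)

text \<open>The fixed point \<open>d + \<delta> = b * \<delta>\<close> of the digit \<open>d\<close>; \<open>nu b d j\<close> concentrates there as \<open>j\<close> grows.\<close>

definition \<delta> :: real where "\<delta> = real d / (real b - 1)"

lemma \<delta>_bounds: "0 \<le> \<delta>" "\<delta> \<le> 1"
  using b d by (auto simp: \<delta>_def field_simps)

lemma \<delta>_fixed: "real d + \<delta> = real b * \<delta>"
  using b by (simp add: \<delta>_def field_simps)

lemma \<delta>_eq: "\<delta> = real d / real b + \<delta> / real b"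
  using b \<delta>_fixed by (simp add: add_divide_distrib[symmetric])

lemma integrable_pow_\<delta>: "j \<ge> 1 \<Longrightarrow> integrable (nu b d j) (\<lambda>x. \<bar>x - \<delta>\<bar> ^ n)"
  by (rule integrable_nu[where B = 1]) (use \<delta>_bounds in \<open>auto intro!: power_le_one\<close>)

text \<open>A first digit \<open>d\<close> divides the distance to \<delta> by b, so it contributes
  at most M / b to the moment M. The other digits have total probability (b - 1) / b ^ j and
  contribute at most \<open>u\<close> times that. Solving for M gives the bound.\<close>

lemma moment_le:
  assumes j: "j \<ge> 1" and n: "n \<ge> 1" and u: "\<And>a. a < b \<Longrightarrow> a \<noteq> d \<Longrightarrow>
    E j (\<lambda>x. \<bar>(real a + x) / real b - \<delta>\<bar> ^ n) \<le> u"
  shows "E j (\<lambda>x. \<bar>x - \<delta>\<bar> ^ n) \<le> real b / real b ^ j * u"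
proof -
  let ?p = "pmf (digit_pmf b d j)"
  define M where "M = E j (\<lambda>x. \<bar>x - \<delta>\<bar> ^ n)"
  have M0: "0 \<le> M"
    unfolding M_def by (intro E_nonneg j) auto
  have "M = (\<Sum>a<b. ?p a * E j (\<lambda>x. \<bar>(real a + x) / real b - \<delta>\<bar> ^ n))"
    unfolding M_def
    by (rule E_self_similar[OF j, where B = 1]) (use \<delta>_bounds in \<open>auto intro!: power_le_one\<close>)
  also have "\<dots> = ?p d * E j (\<lambda>x. \<bar>(real d + x) / real b - \<delta>\<bar> ^ n) +
      (\<Sum>a\<in>{..<b} - {d}. ?p a * E j (\<lambda>x. \<bar>(real a + x) / real b - \<delta>\<bar> ^ n))"
    using d by (subst sum.remove[of _ d]) auto
  also have "\<dots> \<le> M / real b + (real b - 1) / real b ^ j * u"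
  proof (rule add_mono)
    have "\<bar>(real d + x) / real b - \<delta>\<bar> = \<bar>x - \<delta>\<bar> / real b" for x
    proof -
      have "(real d + x) / real b - \<delta> = (x - \<delta>) / real b"
        using \<delta>_eq by (simp only: add_divide_distrib diff_divide_distrib)
      then show ?thesis using b by (simp add: abs_divide)
    qed
    then have "E j (\<lambda>x. \<bar>(real d + x) / real b - \<delta>\<bar> ^ n) = M / real b ^ n"
      by (simp add: M_def power_divide)
    also have "\<dots> \<le> M / real b"
      using M0 b n self_le_power[of "real b" n] by (intro divide_left_mono) auto
    finally have "?p d * E j (\<lambda>x. \<bar>(real d + x) / real b - \<delta>\<bar> ^ n) \<le> 1 * (M / real b)"
      using M0 by (intro mult_mono pmf_le_1) auto
    then show "?p d * E j (\<lambda>x. \<bar>(real d + x) / real b - \<delta>\<bar> ^ n) \<le> M / real b"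
      by simp
    have "(\<Sum>a\<in>{..<b} - {d}. ?p a * E j (\<lambda>x. \<bar>(real a + x) / real b - \<delta>\<bar> ^ n)) \<le>
        (\<Sum>a\<in>{..<b} - {d}. 1 / real b ^ j * u)"
      using u by (intro sum_mono) (auto simp: pmf_digit_pmf[OF b d j] intro!: divide_right_mono)
    also have "\<dots> = (real b - 1) / real b ^ j * u"
      using b d by (simp add: of_nat_diff)
    finally show "(\<Sum>a\<in>{..<b} - {d}. ?p a * E j (\<lambda>x. \<bar>(real a + x) / real b - \<delta>\<bar> ^ n)) \<le>
        (real b - 1) / real b ^ j * u" .
  qed
  finally have "M * (real b - 1) / real b \<le> (real b - 1) / real b ^ j * u"
    using b by (simp add: field_simps)
  then have "(real b - 1) * M \<le> (real b - 1) * (real b / real b ^ j * u)"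
    using b by (simp add: field_simps)
  then show ?thesis
    unfolding M_def by (rule mult_left_le_imp_le) (use b in simp)
qed

lemma moment_le_coarse:
  assumes j: "j \<ge> 1" and n: "n \<ge> 1"
  shows "E j (\<lambda>x. \<bar>x - \<delta>\<bar> ^ n) \<le> real b / real b ^ j"
proof -
  have "E j (\<lambda>x. \<bar>x - \<delta>\<bar> ^ n) \<le> real b / real b ^ j * 1"
  proof (rule moment_le[OF j n])
    fix a assume a: "a < b"
    have le: "\<bar>(real a + x) / real b - \<delta>\<bar> \<le> 1" if "0 \<le> x" "x < 1" for x
      using digit_interval[OF a that] \<delta>_bounds by linarith
    have "E j (\<lambda>x. \<bar>(real a + x) / real b - \<delta>\<bar> ^ n) \<le> E j (\<lambda>_. 1)"
      by (intro E_mono integrable_nu[where B = 1] j) (use le in \<open>auto intro!: power_le_one\<close>)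
    then show "E j (\<lambda>x. \<bar>(real a + x) / real b - \<delta>\<bar> ^ n) \<le> 1"
      by simp
  qed
  then show ?thesis by simp
qed

text \<open>Let q = (b - 1) / b and let y be the distance of the remaining digits from \<delta>. A
  first digit other than \<open>d\<close> leads to distance at most q + y / b, whose n-th power is
  at most q ^ n + y by convexity; the mean of y is small by \<open>moment_le_coarse\<close>.\<close>

lemma moment_le_fine:
  assumes j: "j \<ge> 1" and n: "n \<ge> 1"
  shows "E j (\<lambda>x. \<bar>x - \<delta>\<bar> ^ n) \<le>
    real b / real b ^ j * (((real b - 1) / real b) ^ n + real b / real b ^ j)"
proof (rule moment_le[OF j n])
  define q where "q = (real b - 1) / real b"
  have q: "0 \<le> q" "q \<le> 1" using b by (auto simp: q_def)
  fix a assume a: "a < b" "a \<noteq> d"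
  have le: "\<bar>(real a + x) / real b - \<delta>\<bar> ^ n \<le> q ^ n + \<bar>x - \<delta>\<bar> ^ 1"
    if "0 \<le> x" "x < 1" for x
  proof -
    define y where "y = \<bar>x - \<delta>\<bar>"
    have y: "0 \<le> y" "y \<le> 1" using that \<delta>_bounds by (auto simp: y_def)
    have "(real a + x) / real b - \<delta> = (real a - real d) / real b + (x - \<delta>) / real b"
      using \<delta>_eq by (simp only: add_divide_distrib diff_divide_distrib)
    then have "\<bar>(real a + x) / real b - \<delta>\<bar> \<le> \<bar>real a - real d\<bar> / real b + y / real b"
      using abs_triangle_ineq[of "(real a - real d) / real b" "(x - \<delta>) / real b"] b
      by (simp add: y_def abs_divide)
    also have "\<dots> \<le> q + y / real b"
      using a d b by (auto simp: q_def intro!: divide_right_mono)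
    \<comment> \<open>Since 1 - q = 1 / b, this is a convex combination of q and 1.\<close>
    also have "\<dots> = (1 - y) * q + y * 1"
      using b by (simp add: q_def field_simps)
    finally have "\<bar>(real a + x) / real b - \<delta>\<bar> ^ n \<le> ((1 - y) * q + y * 1) ^ n"
      by (intro power_mono) auto
    also have "\<dots> \<le> (1 - y) * q ^ n + y * 1 ^ n"
    proof -
      have "convex_on {0::real..} (\<lambda>x. x ^ n)"
        by (cases "even n") (auto intro: convex_power_odd convex_on_subset[OF convex_power_even])
      from convex_onD[OF this, of y q 1] show ?thesis using y q by simp
    qed
    also have "\<dots> \<le> q ^ n + y"
      using y q by (simp add: mult_left_le_one_le)
    finally show ?thesis by (simp add: y_def)
  qed
  have "E j (\<lambda>x. \<bar>(real a + x) / real b - \<delta>\<bar> ^ n) \<le> E j (\<lambda>x. q ^ n + \<bar>x - \<delta>\<bar> ^ 1)"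
  proof (intro E_mono le j)
    have le: "\<bar>(real a + x) / real b - \<delta>\<bar> \<le> 1" if "0 \<le> x" "x < 1" for x
      using digit_interval[OF a(1) that] \<delta>_bounds by linarith
    show "integrable (nu b d j) (\<lambda>x. \<bar>(real a + x) / real b - \<delta>\<bar> ^ n)"
      by (intro integrable_nu[where B = 1] j) (use le in \<open>auto intro!: power_le_one\<close>)
    show "integrable (nu b d j) (\<lambda>x. q ^ n + \<bar>x - \<delta>\<bar> ^ 1)"
      by (intro integrable_nu[where B = "q ^ n + 1"] j) (use \<delta>_bounds q in auto)
  qed
  also have "\<dots> = q ^ n + E j (\<lambda>x. \<bar>x - \<delta>\<bar> ^ 1)"
  proof -
    have "E j (\<lambda>x. q ^ n + \<bar>x - \<delta>\<bar> ^ 1) = E j (\<lambda>_. q ^ n) + E j (\<lambda>x. \<bar>x - \<delta>\<bar> ^ 1)"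
      by (intro Bochner_Integration.integral_add integrable_pow_\<delta> j integrable_nu[where B = "q ^ n"])
        (use q in auto)
    then show ?thesis by simp
  qed
  also have "\<dots> \<le> q ^ n + real b / real b ^ j"
    using moment_le_coarse[OF j, of 1] by simp
  finally show "E j (\<lambda>x. \<bar>(real a + x) / real b - \<delta>\<bar> ^ n) \<le>
      ((real b - 1) / real b) ^ n + real b / real b ^ j"
    by (simp add: q_def)
qed

subsection \<open>Growth of the coefficients\<close>

lemma Q_Suc:
  assumes "i \<le> j"
  shows "Q b d (Suc i) (Suc j) =
    (- 1) ^ (j - i) * real (j choose i) * E (Suc i) (\<lambda>x. (real d + x) ^ (j - i))"
proof -
  have "(LINT x:{0..<1}|nu b d (Suc i). (real d + x) ^ (j - i)) =
      E (Suc i) (\<lambda>x. (real d + x) ^ (j - i))"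
    unfolding set_lebesgue_integral_def by (rule E_cong) auto
  then show ?thesis
    using assms by (simp add: Q_def)
qed

lemma c_row: "(\<Sum>i\<le>j. c b d (Suc i) * Q b d (Suc i) (Suc j)) = (if j = 0 then 1 else 0)"
proof -
  have "ut_mult (ut_inverse (Q b d)) (Q b d) 1 (Suc j) = ut_id 1 (Suc j)"
    using ut_inverse_Q[OF b d] by simp
  then have "(\<Sum>k=Suc 0..Suc j. c b d k * Q b d k (Suc j)) = (if j = 0 then 1 else 0)"
    by (auto simp: ut_mult_def ut_id_def c_def)
  then show ?thesis
    by (subst (asm) sum.shift_bounds_cl_Suc_ivl) (simp add: atMost_atLeast0)
qed

text \<open>On polynomials \<open>f\<close>, the sum of \<open>c j\<close> times the integral of
  \<open>(-1) ^ (j - 1) / (j - 1)!\<close> times the \<open>(j - 1)\<close>-st derivative of \<open>f\<close> with respect to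
  \<open>nu b d j\<close> is \<open>f (- d)\<close>: on the powers of \<open>d + x\<close> this is the definition of \<open>c\<close>.
  Here it is read off on the powers of \<open>s - x\<close> for arbitrary \<open>s\<close>.\<close>

lemma c_functional:
  "(\<Sum>i\<le>n. c b d (Suc i) * real (n choose i) * E (Suc i) (\<lambda>x. (s - x) ^ (n - i))) =
    (s + real d) ^ n"
proof -
  let ?m = "\<lambda>i k. E (Suc i) (\<lambda>x. (real d + x) ^ k)"
  let ?t = "\<lambda>i j. real (n - i choose (j - i)) * (s + real d) ^ (n - j) * ((- 1) ^ (j - i) * ?m i (j - i))"
  have E: "E (Suc i) (\<lambda>x. (s - x) ^ (n - i)) = (\<Sum>j\<in>{j\<in>{..n}. i \<le> j}. ?t i j)"
    if i: "i \<le> n" for i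
  proof -
    have int: "integrable (nu b d (Suc i)) (\<lambda>x. (real d + x) ^ k)" for k
      by (rule integrable_nu[where B = "(real d + 1) ^ k"]) (auto simp: power_mono)
    \<comment> \<open>Writing s - x = (s + d) - (d + x) brings in the moments that make up
      \<open>Q\<close>.\<close>
    have "(s - x) ^ (n - i) = (\<Sum>k\<le>n - i. real (n - i choose k) * (s + real d) ^ (n - i - k) *
        ((- 1) ^ k * (real d + x) ^ k))" for x
    proof -
      have "(s - x) ^ (n - i) = (- (real d + x) + (s + real d)) ^ (n - i)" by simp
      also have "\<dots> = (\<Sum>k\<le>n - i. real (n - i choose k) * (- (real d + x)) ^ k * (s + real d) ^ (n - i - k))"
        by (rule binomial_ring)
      finally show ?thesis
        by (simp only: power_minus[of "real d + x"] mult_ac)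
    qed
    then have "E (Suc i) (\<lambda>x. (s - x) ^ (n - i)) = (\<Sum>k\<le>n - i. real (n - i choose k) *
        (s + real d) ^ (n - i - k) * ((- 1) ^ k * ?m i k))"
      using int by simp
    also have "\<dots> = (\<Sum>j\<in>{j\<in>{..n}. i \<le> j}. ?t i j)"
      by (rule sum.reindex_bij_witness[of _ "\<lambda>j. j - i" "\<lambda>k. k + i"]) (use i in \<open>auto simp: add.commute\<close>)
    finally show ?thesis .
  qed
  have "(\<Sum>i\<le>n. c b d (Suc i) * real (n choose i) * E (Suc i) (\<lambda>x. (s - x) ^ (n - i))) =
      (\<Sum>i\<le>n. \<Sum>j\<in>{j\<in>{..n}. i \<le> j}. c b d (Suc i) * real (n choose i) * ?t i j)"
    using E by (intro sum.cong refl) (simp add: sum_distrib_left)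
  also have "\<dots> = (\<Sum>j\<le>n. \<Sum>i\<in>{i\<in>{..n}. i \<le> j}. c b d (Suc i) * real (n choose i) * ?t i j)"
    by (rule sum.swap_restrict) auto
  \<comment> \<open>Trinomial revision turns the inner sum into an entry of the first row of the
    inverse of \<open>Q\<close> times \<open>Q\<close>; by \<open>c_row\<close> only j = 0
    survives.\<close>
  also have "\<dots> = (\<Sum>j\<le>n. real (n choose j) * (s + real d) ^ (n - j) *
      (\<Sum>i\<le>j. c b d (Suc i) * Q b d (Suc i) (Suc j)))"
  proof (rule sum.cong[OF refl])
    fix j assume "j \<in> {..n}"
    then have j: "j \<le> n" by simp
    have "c b d (Suc i) * real (n choose i) * ?t i j =
        real (n choose j) * (s + real d) ^ (n - j) * (c b d (Suc i) * Q b d (Suc i) (Suc j))"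
      if i: "i \<le> j" for i
    proof -
      have "(n choose i) * (n - i choose (j - i)) = (n choose j) * (j choose i)"
        using choose_mult[OF i j] by simp
      then have "real (n choose i) * real (n - i choose (j - i)) = real (n choose j) * real (j choose i)"
        by (simp flip: of_nat_mult)
      then show ?thesis
        using i by (simp add: Q_Suc mult_ac)
    qed
    moreover have "{i\<in>{..n}. i \<le> j} = {..j}" using j by auto
    ultimately show "(\<Sum>i\<in>{i\<in>{..n}. i \<le> j}. c b d (Suc i) * real (n choose i) * ?t i j) =
        real (n choose j) * (s + real d) ^ (n - j) * (\<Sum>i\<le>j. c b d (Suc i) * Q b d (Suc i) (Suc j))"
      unfolding sum_distrib_left by (intro sum.cong) auto
  qed
  also have "\<dots> = (\<Sum>j\<le>n. if j = 0 then (s + real d) ^ n else 0)"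
    unfolding c_row by (intro sum.cong) auto
  also have "\<dots> = (s + real d) ^ n" by simp
  finally show ?thesis .
qed

text \<open>The moments of \<open>nu b d j\<close> around \<open>\<delta>\<close> make \<open>c j\<close> grow at most like \<open>\<rho> ^ j\<close>.
  What matters is \<open>\<rho> < b + d\<close>, as \<open>b + d\<close> is the least value of \<open>b * n + d + x\<close> in the final sum.\<close>

definition \<rho> :: real where "\<rho> = real d + 3 / 2"

lemma \<rho>_ge: "\<rho> \<ge> 3 / 2" by (simp add: \<rho>_def)

text \<open>This is \<open>c_functional\<close> at s = \<delta>, solved for the top term i = n,
  whose integral is 1. The other integrals are moments about \<delta>, bounded by
  \<open>moment_le_fine\<close>.\<close>

lemma c_step:
  "\<bar>c b d (Suc n)\<bar> \<le> \<rho> ^ n + (\<Sum>i<n. \<bar>c b d (Suc i)\<bar> * real (n choose i) *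
     (((real b - 1) / real b) ^ (n - i) / real b ^ i + 1 / (real b ^ 2) ^ i))"
proof -
  let ?e = "\<lambda>i. E (Suc i) (\<lambda>x. (\<delta> - x) ^ (n - i))"
  have "\<bar>?e i\<bar> \<le> ((real b - 1) / real b) ^ (n - i) / real b ^ i + 1 / (real b ^ 2) ^ i"
    if "i < n" for i
  proof -
    have "\<bar>?e i\<bar> \<le> E (Suc i) (\<lambda>x. \<bar>(\<delta> - x) ^ (n - i)\<bar>)"
      by (rule integral_abs_bound)
    also have "\<dots> = E (Suc i) (\<lambda>x. \<bar>x - \<delta>\<bar> ^ (n - i))"
      by (simp add: power_abs abs_minus_commute)
    also have "\<dots> \<le> real b / real b ^ Suc i * (((real b - 1) / real b) ^ (n - i) + real b / real b ^ Suc i)"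
      using that by (intro moment_le_fine) auto
    also have "\<dots> = ((real b - 1) / real b) ^ (n - i) / real b ^ i + 1 / (real b ^ 2) ^ i"
      using b by (simp add: distrib_left power_mult_distrib power2_eq_square mult_ac)
    finally show ?thesis .
  qed
  then have s: "\<bar>\<Sum>i<n. c b d (Suc i) * real (n choose i) * ?e i\<bar> \<le>
     (\<Sum>i<n. \<bar>c b d (Suc i)\<bar> * real (n choose i) *
     (((real b - 1) / real b) ^ (n - i) / real b ^ i + 1 / (real b ^ 2) ^ i))"
    by (intro order.trans[OF sum_abs] sum_mono) (auto simp: abs_mult intro!: mult_left_mono)
  have "{..n} = insert n {..<n}" by auto
  then have "c b d (Suc n) = (\<delta> + real d) ^ n - (\<Sum>i<n. c b d (Suc i) * real (n choose i) * ?e i)"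
    using c_functional[of n \<delta>] by simp
  moreover have "\<bar>(\<delta> + real d) ^ n\<bar> \<le> \<rho> ^ n"
    using \<delta>_bounds by (simp add: power_abs \<rho>_def power_mono)
  ultimately show ?thesis using s by linarith
qed

text \<open>Strong induction on \<open>c_step\<close>: with K \<rho> ^ i inserted, the binomial
  theorem sums the two parts to K (\<rho> / b + (b - 1) / b) ^ n and K (\<rho> / b ^ 2 + 1) ^ n, and
  both bases are below \<rho> by a fixed factor.\<close>

lemma c_bound: "\<exists>K. \<forall>n. \<bar>c b d (Suc n)\<bar> \<le> K * \<rho> ^ n"
proof -
  \<comment> \<open>Both bases are at most r \<rho> when \<rho> \<ge> 3 / 2 and b \<ge> 2, with
    equality for \<rho> / b ^ 2 + 1 at \<rho> = 3 / 2, b = 2.\<close>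
  define r :: real where "r = 11 / 12"
  have "(\<lambda>n. r ^ n) \<longlonglongrightarrow> 0" by (rule LIMSEQ_realpow_zero) (auto simp: r_def)
  then have "\<forall>\<^sub>F n in sequentially. r ^ n < 1 / 4"
    by (rule order_tendstoD) simp
  then obtain N where N: "\<And>n. n \<ge> N \<Longrightarrow> r ^ n < 1 / 4"
    by (auto simp: eventually_sequentially)
  \<comment> \<open>The finite sum covers n < N. For n \<ge> N the two parts take at most 2 r ^ n <
    1 / 2 of K \<rho> ^ n, and K \<ge> 2 fits the term \<rho> ^ n into the other half.\<close>
  define K where "K = 2 + (\<Sum>i<N. \<bar>c b d (Suc i)\<bar>)"
  have K: "K \<ge> 2" unfolding K_def by (simp add: sum_nonneg)
  have q: "0 \<le> (real b - 1) / real b" using b by simp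
  have "\<bar>c b d (Suc n)\<bar> \<le> K * \<rho> ^ n" for n
  proof (induction n rule: less_induct)
    case (less n)
    show ?case
    proof (cases "n < N")
      case True
      then have "\<bar>c b d (Suc n)\<bar> \<le> (\<Sum>i<N. \<bar>c b d (Suc i)\<bar>)"
        by (intro member_le_sum) auto
      then have "\<bar>c b d (Suc n)\<bar> \<le> K" by (simp add: K_def)
      also have "K * 1 \<le> K * \<rho> ^ n"
        using K \<rho>_ge by (intro mult_left_mono one_le_power) auto
      finally show ?thesis by simp
    next
      case False
      let ?q = "(real b - 1) / real b"
      have "(\<Sum>i<n. \<bar>c b d (Suc i)\<bar> * real (n choose i) * (?q ^ (n - i) / real b ^ i + 1 / (real b ^ 2) ^ i))
        \<le> (\<Sum>i<n. K * \<rho> ^ i * real (n choose i) * (?q ^ (n - i) / real b ^ i + 1 / (real b ^ 2) ^ i))"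
        using less q by (intro sum_mono mult_right_mono) auto
      also have "\<dots> \<le> (\<Sum>i\<le>n. K * \<rho> ^ i * real (n choose i) * (?q ^ (n - i) / real b ^ i + 1 / (real b ^ 2) ^ i))"
        using K \<rho>_ge q by (intro sum_mono2) auto
      also have "\<dots> = K * ((\<Sum>i\<le>n. real (n choose i) * (\<rho> / real b) ^ i * ?q ^ (n - i)) +
          (\<Sum>i\<le>n. real (n choose i) * (\<rho> / real b ^ 2) ^ i * 1 ^ (n - i)))"
        by (simp add: sum_distrib_left sum.distrib[symmetric] power_divide distrib_left mult_ac)
      also have "\<dots> = K * ((\<rho> / real b + ?q) ^ n + (\<rho> / real b ^ 2 + 1) ^ n)"
        by (simp only: binomial_ring)
      also have "\<dots> \<le> K * ((r * \<rho>) ^ n + (r * \<rho>) ^ n)"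
      proof (intro mult_left_mono add_mono power_mono)
        have b2: "real b \<ge> 2" using b by simp
        have "(\<rho> - 1) / real b \<le> (\<rho> - 1) / 2"
          using \<rho>_ge b2 by (intro divide_left_mono) auto
        then show "\<rho> / real b + ?q \<le> r * \<rho>"
          using \<rho>_ge b by (simp add: r_def diff_divide_distrib)
        have "real b ^ 2 \<ge> 2 ^ 2" using b2 by (intro power_mono) auto
        then have "\<rho> / real b ^ 2 \<le> \<rho> / 4"
          using \<rho>_ge b by (intro divide_left_mono) auto
        then show "\<rho> / real b ^ 2 + 1 \<le> r * \<rho>"
          using \<rho>_ge unfolding r_def by linarith
        show "0 \<le> \<rho> / real b + ?q" "0 \<le> \<rho> / real b ^ 2 + 1" "0 \<le> K"
          using \<rho>_ge q K b by auto
      qed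
      also have "\<dots> = K * \<rho> ^ n * (2 * r ^ n)" by (simp add: power_mult_distrib)
      also have "\<dots> \<le> K * \<rho> ^ n * (1 / 2)"
        using N[of n] False K \<rho>_ge by (intro mult_left_mono) auto
      finally have "\<bar>c b d (Suc n)\<bar> \<le> \<rho> ^ n + K * \<rho> ^ n * (1 / 2)"
        using c_step[of n] by linarith
      also have "\<dots> \<le> (K / 2) * \<rho> ^ n + K * \<rho> ^ n * (1 / 2)"
        using K \<rho>_ge by (intro add_right_mono) (simp add: mult_le_cancel_right1)
      finally show ?thesis by simp
    qed
  qed
  then show ?thesis by blast
qed

lemma E_bounds:
  assumes j: "j \<ge> 1" and f: "f \<in> borel_measurable borel"
    and "\<And>x. 0 \<le> x \<Longrightarrow> x < 1 \<Longrightarrow> 0 \<le> f x" "\<And>x. 0 \<le> x \<Longrightarrow> x < 1 \<Longrightarrow> f x \<le> B"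
  shows "0 \<le> E j f" "E j f \<le> B"
proof -
  show "0 \<le> E j f" by (rule E_nonneg) (use assms in auto)
  have "E j f \<le> E j (\<lambda>_. B)"
    by (rule E_mono[OF j integrable_nu[OF j f] integrable_nu[OF j]]) (use assms in auto)
  then show "E j f \<le> B" by simp
qed

subsection \<open>Expansion of the reciprocal\<close>

text \<open>The series of \<open>neg_binomial_sums\<close> at y = 1 - x, integrated term by term.
  The terms at x = 0 dominate, and their series converges because w > 1.\<close>

lemma E_neg_binomial_sums:
  assumes "w > 1"
  shows "(\<lambda>m. real (m choose j) * E (Suc j) (\<lambda>x. (1 - x) ^ (m - j)) / w ^ Suc m) sums
    E (Suc j) (\<lambda>x. 1 / (w - (1 - x)) ^ Suc j)"
proof -
  let ?f = "\<lambda>m x. real (m choose j) * (1 - x) ^ (m - j) / w ^ Suc m :: real"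
  have bnd: "\<bar>?f m x\<bar> \<le> real (m choose j) * 1 ^ (m - j) / w ^ Suc m" if "0 \<le> x" "x < 1" for m x
    using that assms by (auto simp: abs_mult intro!: divide_right_mono mult_left_le power_le_one)
  have int: "integrable (nu b d (Suc j)) (?f m)" for m
    by (rule integrable_nu[OF _ _ bnd]) auto
  have pt: "?f m x \<ge> 0" "(\<lambda>m. ?f m x) sums (1 / (w - (1 - x)) ^ Suc j)" if "0 \<le> x" "x < 1" for x m
    using neg_binomial_sums[of "1 - x" w j] that assms by auto
  have AE: "AE x in nu b d (Suc j). 0 \<le> x \<and> x < 1"
    using AE_nu_in_unit[OF b d, of "Suc j"] by simp
  have "(\<lambda>m. E (Suc j) (?f m)) sums E (Suc j) (\<lambda>x. \<Sum>m. ?f m x)"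
  proof (rule sums_integral[OF int])
    show "AE x in nu b d (Suc j). summable (\<lambda>m. norm (?f m x))"
      using AE
    proof eventually_elim
      case (elim x)
      have eq: "(\<lambda>m. norm (?f m x)) = (\<lambda>m. ?f m x)"
        using elim by (simp only: real_norm_def abs_of_nonneg[OF pt(1)])
      show ?case
        unfolding eq using pt(2)[of x] elim by (blast intro: sums_summable)
    qed
    show "summable (\<lambda>m. E (Suc j) (\<lambda>x. norm (?f m x)))"
    proof (rule summable_comparison_test'[of _ 0])
      show "summable (\<lambda>m. real (m choose j) * 1 ^ (m - j) / w ^ Suc m)"
        using neg_binomial_sums[of 1 w j] assms by (simp add: sums_iff)
      have "0 \<le> E (Suc j) (\<lambda>x. norm (?f m x))"
        "E (Suc j) (\<lambda>x. norm (?f m x)) \<le> real (m choose j) * 1 ^ (m - j) / w ^ Suc m" for m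
        by (rule E_bounds; use bnd in auto)+
      then show "norm (E (Suc j) (\<lambda>x. norm (?f m x))) \<le> real (m choose j) * 1 ^ (m - j) / w ^ Suc m" for m
        by simp
    qed
  qed
  also have "E (Suc j) (\<lambda>x. \<Sum>m. ?f m x) = E (Suc j) (\<lambda>x. 1 / (w - (1 - x)) ^ Suc j)"
    by (rule E_cong) (use sums_unique[OF pt(2)] in auto)
  finally show ?thesis by simp
qed

text \<open>With w = z + d + 1, 1 / z is the sum over m of (1 + d) ^ m / w ^ (m + 1). By
  \<open>c_functional\<close> each numerator is a finite sum over j; after the swap,
  \<open>E_neg_binomial_sums\<close> evaluates the sum over m. The constant 3 / 2 is \<rho> - d, so
  K \<rho> ^ j / (z + d) ^ (j + 1) is a convergent geometric majorant.\<close>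

lemma c_resolvent:
  assumes K: "\<And>n. \<bar>c b d (Suc n)\<bar> \<le> K * \<rho> ^ n" and z: "z > 3 / 2"
  defines "f \<equiv> \<lambda>j. c b d (Suc j) * E (Suc j) (\<lambda>x. 1 / (z + real d + x) ^ Suc j)"
  shows "summable (\<lambda>j. \<bar>f j\<bar>)" "(\<Sum>j. \<bar>f j\<bar>) \<le> K / (z - 3 / 2)" "f sums (1 / z)"
proof -
  have \<rho>: "\<rho> > 0" "z + real d - \<rho> = z - 3 / 2" by (auto simp: \<rho>_def)
  have fb: "\<bar>f j\<bar> \<le> K / (z + real d) * (\<rho> / (z + real d)) ^ j" for j
  proof -
    have "1 / (z + real d + x) ^ Suc j \<le> 1 / (z + real d) ^ Suc j" if "0 \<le> x" for x
      using z that by (intro divide_left_mono power_mono mult_pos_pos zero_less_power) auto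
    then have "0 \<le> E (Suc j) (\<lambda>x. 1 / (z + real d + x) ^ Suc j)"
      "E (Suc j) (\<lambda>x. 1 / (z + real d + x) ^ Suc j) \<le> 1 / (z + real d) ^ Suc j"
      using z by (intro E_bounds[where B = "1 / (z + real d) ^ Suc j"]; simp)+
    then have "\<bar>f j\<bar> \<le> K * \<rho> ^ j * (1 / (z + real d) ^ Suc j)"
      unfolding f_def abs_mult using K[of j] by (intro mult_mono) auto
    then show ?thesis by (simp add: power_divide mult_ac)
  qed
  have "(\<lambda>j. K / (z + real d) * (\<rho> / (z + real d)) ^ j) sums (K / (z + real d) * (1 / (1 - \<rho> / (z + real d))))"
    using \<rho> z by (intro sums_mult geometric_sums) auto
  also have "K / (z + real d) * (1 / (1 - \<rho> / (z + real d))) = K / (z - 3 / 2)"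
  proof -
    have "(z + real d) * (1 - \<rho> / (z + real d)) = z - 3 / 2"
      using \<rho> z by (simp add: right_diff_distrib)
    then show ?thesis by (simp only: times_divide_times_eq mult_1_right)
  qed
  finally have geo: "(\<lambda>j. K / (z + real d) * (\<rho> / (z + real d)) ^ j) sums (K / (z - 3 / 2))" .
  show sm: "summable (\<lambda>j. \<bar>f j\<bar>)"
    by (rule summable_comparison_test'[OF sums_summable[OF geo], of 0]) (use fb in auto)
  show "(\<Sum>j. \<bar>f j\<bar>) \<le> K / (z - 3 / 2)"
    using suminf_le[OF fb sm sums_summable[OF geo]] sums_unique[OF geo] by simp

  text \<open>Expanding around \<open>x = 1\<close>, to the right of the support, keeps all terms of
    \<open>1 / (z + d + x)\<close> positive; this gives convergence for all \<open>z > 3/2\<close>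
    and not only for large \<open>z\<close>.\<close>
  define w where "w = z + real d + 1"
  have w: "w > 1" "w > 1 + \<rho>" "w - (1 + real d) = z" using z by (auto simp: w_def \<rho>_def)
  let ?m = "\<lambda>m j. E (Suc j) (\<lambda>x. (1 - x) ^ (m - j))"
  let ?g = "\<lambda>m j. c b d (Suc j) * (real (m choose j) * ?m m j / w ^ Suc m)"
  have m: "\<bar>?m m j\<bar> \<le> 1" for m j
    using E_bounds[of "Suc j" "\<lambda>x. (1 - x) ^ (m - j)" 1] by (auto simp: power_le_one)
  have geo2: "(\<lambda>m. y ^ m / w ^ Suc m) sums (1 / (w - y))" if "0 \<le> y" "y < w" for y
    using neg_binomial_sums[OF that, of 0] by simp
  have "(\<lambda>j. \<Sum>\<^sub>\<infinity>m. ?g m j) sums (\<Sum>\<^sub>\<infinity>m. \<Sum>j. ?g m j)"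
  proof (rule sums_infsum_swap)
    show "summable (\<lambda>j. \<bar>?g m j\<bar>)" for m
      by (rule summable_finite[of "{..m}"]) auto
    show "(\<Sum>j. \<bar>?g m j\<bar>) \<le> K * (1 + \<rho>) ^ m / w ^ Suc m" for m
    proof -
      have "(\<Sum>j. \<bar>?g m j\<bar>) = (\<Sum>j\<le>m. \<bar>?g m j\<bar>)"
        by (rule suminf_finite) auto
      also have "\<dots> \<le> (\<Sum>j\<le>m. K * \<rho> ^ j * (real (m choose j) * 1 / w ^ Suc m))"
        unfolding abs_mult[of "c b d (Suc _)"]
      proof (intro sum_mono mult_mono K)
        fix j
        show "\<bar>real (m choose j) * ?m m j / w ^ Suc m\<bar> \<le> real (m choose j) * 1 / w ^ Suc m"
          using w m[of j m] by (simp add: abs_mult abs_divide mult_left_le divide_right_mono)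
        show "0 \<le> K * \<rho> ^ j" using K[of j] by linarith
      qed auto
      also have "\<dots> = K * (\<Sum>j\<le>m. real (m choose j) * \<rho> ^ j * 1 ^ (m - j)) / w ^ Suc m"
        by (simp add: sum_distrib_left sum_divide_distrib mult_ac)
      also have "\<dots> = K * (\<rho> + 1) ^ m / w ^ Suc m"
        by (simp only: binomial_ring)
      finally show ?thesis by (simp add: add.commute)
    qed
    \<comment> \<open>The condition w > 1 + \<rho> is again z > 3 / 2.\<close>
    have "(\<lambda>m. K * ((1 + \<rho>) ^ m / w ^ Suc m)) sums (K * (1 / (w - (1 + \<rho>))))"
      using w \<rho> by (intro sums_mult geo2) auto
    moreover have "K \<ge> 0" using K[of 0] by simp
    ultimately show "(\<lambda>m. K * (1 + \<rho>) ^ m / w ^ Suc m) summable_on UNIV"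
      using w \<rho> by (subst summable_on_UNIV_nonneg_real_iff) (auto simp: sums_iff)
  qed
  also have "(\<lambda>j. \<Sum>\<^sub>\<infinity>m. ?g m j) = f"
  proof
    fix j
    let ?h = "\<lambda>m. real (m choose j) * ?m m j / w ^ Suc m"
    have "?h sums E (Suc j) (\<lambda>x. 1 / (w - (1 - x)) ^ Suc j)"
      by (rule E_neg_binomial_sums[OF w(1)])
    moreover have "?h m \<ge> 0" for m
      using E_bounds(1)[of "Suc j" "\<lambda>x. (1 - x) ^ (m - j)" 1] w by (auto simp: power_le_one)
    ultimately have "(?h has_sum E (Suc j) (\<lambda>x. 1 / (w - (1 - x)) ^ Suc j)) UNIV"
      by (intro sums_nonneg_imp_has_sum) auto
    then have "infsum ?h UNIV = E (Suc j) (\<lambda>x. 1 / (w - (1 - x)) ^ Suc j)"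
      by (rule infsumI)
    moreover have "w - (1 - x) = z + real d + x" for x by (simp add: w_def)
    ultimately show "(\<Sum>\<^sub>\<infinity>m. ?g m j) = f j"
      by (simp only: infsum_cmult_right' f_def)
  qed
  \<comment> \<open>This is \<open>c_functional\<close> at s = 1.\<close>
  also have "(\<lambda>m. \<Sum>j. ?g m j) = (\<lambda>m. (1 + real d) ^ m / w ^ Suc m)"
  proof
    fix m
    have "(\<Sum>j. ?g m j) = (\<Sum>j\<le>m. ?g m j)"
      by (rule suminf_finite) auto
    also have "\<dots> = (\<Sum>j\<le>m. c b d (Suc j) * real (m choose j) * ?m m j) / w ^ Suc m"
      by (simp add: sum_divide_distrib mult_ac)
    finally show "(\<Sum>j. ?g m j) = (1 + real d) ^ m / w ^ Suc m"
      by (simp only: c_functional)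
  qed
  also have "(\<Sum>\<^sub>\<infinity>m. (1 + real d) ^ m / w ^ Suc m) = 1 / z"
  proof -
    have "((\<lambda>m. (1 + real d) ^ m / w ^ Suc m) has_sum (1 / (w - (1 + real d)))) UNIV"
      using w z by (intro sums_nonneg_imp_has_sum geo2) (auto simp: w_def)
    then show ?thesis using w by (simp add: infsumI)
  qed
  finally show "f sums (1 / z)" .
qed

subsection \<open>Summation over integers with a given digit count\<close>

lemma irwin_append:
  assumes "m > 0" "a < b"
  shows "b * m + a \<in> irwin_set b d k \<longleftrightarrow>
    (if a = d then k > 0 \<and> m \<in> irwin_set b d (k - 1) else m \<in> irwin_set b d k)"
  using digit_count_append[OF b assms] b assms by (auto simp: irwin_set_def)

lemma irwin_pos: "n \<in> irwin_set b d k \<Longrightarrow> n > 0"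
  by (simp add: irwin_set_def)

lemma irwin_single:
  assumes "a < b"
  shows "a \<in> irwin_set b d k \<longleftrightarrow> a > 0 \<and> k = (if a = d then 1 else 0)"
  using digit_count_single[OF b _ assms] by (auto simp: irwin_set_def)

text \<open>The reciprocals in \<open>irwin_set b d k\<close> below \<open>b ^ L\<close> sum to \<open>T\<^sub>k L\<close> with
  \<open>T\<^sub>k (L + 1) \<le> b + (1 - 1 / b) * T\<^sub>k L + T\<^sub>k\<^sub>-\<^sub>1 L / b\<close>, so \<open>b\<^sup>2 * (k + 1)\<close> bounds them.\<close>

lemma irwin_partial_sum_le:
  "(\<Sum>n\<in>irwin_set b d k \<inter> {..<b ^ L}. 1 / real n) \<le> real b ^ 2 * real (k + 1)"
proof (induction L arbitrary: k)
  case 0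
  have "irwin_set b d k \<inter> {..<b ^ 0} = {}" by (auto simp: irwin_set_def)
  then show ?case by simp
next
  case (Suc L)
  define T where "T k = (\<Sum>n\<in>irwin_set b d k \<inter> {..<b ^ L}. 1 / real n)" for k
  \<comment> \<open>The prefixes below b ^ L to which the digit \<open>a\<close> can be appended to
    reach digit count \<open>k\<close>.\<close>
  define A where "A a = (if a = d then if k > 0 then irwin_set b d (k - 1) else {} else irwin_set b d k)
    \<inter> {..<b ^ L}" for a
  have T: "T k \<le> real b ^ 2 * real (k + 1)" for k
    using Suc by (simp add: T_def)
  have A0: "m > 0" if "m \<in> A a" for m a
    using that by (auto simp: A_def irwin_set_def split: if_splits)
  have fin: "finite (A a)" for a by (auto simp: A_def)
  have sub: "irwin_set b d k \<inter> {..<b ^ Suc L} \<subseteq> {1..<b} \<union> (\<Union>a\<in>{..<b}. (\<lambda>m. b * m + a) ` A a)"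
  proof
    fix n assume n: "n \<in> irwin_set b d k \<inter> {..<b ^ Suc L}"
    show "n \<in> {1..<b} \<union> (\<Union>a\<in>{..<b}. (\<lambda>m. b * m + a) ` A a)"
    proof (cases "n < b")
      case True
      then show ?thesis using n by (auto simp: irwin_set_def)
    next
      case False
      define m a where "m = n div b" and "a = n mod b"
      have ma: "n = b * m + a" "a < b" "m > 0"
        using False b by (auto simp: m_def a_def div_greater_zero_iff)
      have "m < b ^ L"
        using n b by (auto simp: m_def less_mult_imp_div_less mult.commute)
      then have "m \<in> A a"
        using n irwin_append[OF ma(3,2), of k] ma(1) by (auto simp: A_def)
      then show ?thesis using ma by auto
    qed
  qed
  have "T' \<le> real b ^ 2 * real (k + 1)" if T': "T' = (\<Sum>n\<in>irwin_set b d k \<inter> {..<b ^ Suc L}. 1 / real n)" for T'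
  proof -
    have "T' \<le> (\<Sum>n\<in>{1..<b} \<union> (\<Union>a\<in>{..<b}. (\<lambda>m. b * m + a) ` A a). 1 / real n)"
      unfolding T' using sub fin by (intro sum_mono2) auto
    also have "\<dots> \<le> (\<Sum>n=1..<b. 1 / real n) + (\<Sum>n\<in>(\<Union>a\<in>{..<b}. (\<lambda>m. b * m + a) ` A a). 1 / real n)"
      using fin by (subst sum.union_inter[symmetric]) (auto intro!: sum_nonneg)
    also have "(\<Sum>n\<in>(\<Union>a\<in>{..<b}. (\<lambda>m. b * m + a) ` A a). 1 / real n) \<le>
        (\<Sum>a<b. \<Sum>m\<in>A a. 1 / (real b * real m))"
    proof -
      have "(\<Sum>n\<in>(\<Union>a\<in>{..<b}. (\<lambda>m. b * m + a) ` A a). 1 / real n) \<le>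
          (\<Sum>a<b. \<Sum>n\<in>(\<lambda>m. b * m + a) ` A a. 1 / real n)"
      proof (rule eq_refl, rule sum.UNION_disjoint)
        have "a = a'" if "b * m + a = b * m' + a'" "a < b" "a' < b" for m m' a a'
          using arg_cong[OF that(1), of "\<lambda>n. n mod b"] that(2,3) by simp
        then show "\<forall>a\<in>{..<b}. \<forall>a'\<in>{..<b}. a \<noteq> a' \<longrightarrow>
            (\<lambda>m. b * m + a) ` A a \<inter> (\<lambda>m. b * m + a') ` A a' = {}"
          by blast
      qed (use fin in auto)
      also have "\<dots> = (\<Sum>a<b. \<Sum>m\<in>A a. 1 / real (b * m + a))"
        using b by (intro sum.cong[OF refl] sum.reindex[unfolded o_def]) (auto simp: inj_on_def)
      also have "\<dots> \<le> (\<Sum>a<b. \<Sum>m\<in>A a. 1 / (real b * real m))"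
        using b by (intro sum_mono frac_le) (auto dest: A0)
      finally show ?thesis .
    qed
    also have "(\<Sum>n=1..<b. 1 / real n) \<le> (\<Sum>n=1..<b. 1)"
      by (intro sum_mono) auto
    also have "\<dots> = real b - 1" using b by (simp add: of_nat_diff)
    also have "(\<Sum>a<b. \<Sum>m\<in>A a. 1 / (real b * real m)) =
        (\<Sum>m\<in>A d. 1 / (real b * real m)) + (\<Sum>a\<in>{..<b} - {d}. \<Sum>m\<in>A a. 1 / (real b * real m))"
      using d by (subst sum.remove[of _ d]) auto
    also have "(\<Sum>a\<in>{..<b} - {d}. \<Sum>m\<in>A a. 1 / (real b * real m)) = (real b - 1) / real b * T k"
    proof -
      have "(\<Sum>m\<in>A a. 1 / (real b * real m)) = T k / real b" if "a \<noteq> d" for a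
        using that by (simp add: A_def T_def sum_divide_distrib mult.commute)
      then show ?thesis using b d by (simp add: of_nat_diff)
    qed
    also have "(\<Sum>m\<in>A d. 1 / (real b * real m)) \<le> real b * real k"
    proof (cases "k > 0")
      case True
      then have "(\<Sum>m\<in>A d. 1 / (real b * real m)) = T (k - 1) / real b"
        by (simp add: A_def T_def sum_divide_distrib mult.commute)
      also have "\<dots> \<le> real b ^ 2 * real k / real b"
        using T[of "k - 1"] True b by (intro divide_right_mono) auto
      finally show ?thesis using b by (simp add: power2_eq_square)
    qed (simp add: A_def)
    finally have "T' \<le> real b - 1 + (real b * real k + (real b - 1) / real b * T k)"
      by simp
    also have "\<dots> \<le> real b - 1 + (real b * real k + (real b - 1) / real b * (real b ^ 2 * real (k + 1)))"
      using T[of k] b by (intro add_left_mono mult_left_mono) auto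
    \<comment> \<open>The left side equals b ^ 2 (k + 1) - 1.\<close>
    also have "\<dots> \<le> real b ^ 2 * real (k + 1)"
      using b by (simp add: power2_eq_square field_simps)
    finally show ?thesis .
  qed
  then show ?case by blast
qed

lemma summable_irwin: "(\<lambda>n. 1 / real n) summable_on irwin_set b d k"
proof (rule nonneg_bdd_above_summable_on)
  show "bdd_above (sum (\<lambda>n. 1 / real n) ` {F. F \<subseteq> irwin_set b d k \<and> finite F})"
  proof (rule bdd_aboveI2)
    fix F assume F: "F \<in> {F. F \<subseteq> irwin_set b d k \<and> finite F}"
    define L where "L = Max (insert 0 F)"
    have "F \<subseteq> irwin_set b d k \<inter> {..<b ^ L}"
    proof
      fix n assume n: "n \<in> F"
      then have "n \<le> L" using F by (simp add: L_def)
      also have "L < b ^ L" using b power_gt_expt[of b L] by simp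
      finally show "n \<in> irwin_set b d k \<inter> {..<b ^ L}" using n F by auto
    qed
    then have "(\<Sum>n\<in>F. 1 / real n) \<le> (\<Sum>n\<in>irwin_set b d k \<inter> {..<b ^ L}. 1 / real n)"
      by (intro sum_mono2) auto
    also have "\<dots> \<le> real b ^ 2 * real (k + 1)" by (rule irwin_partial_sum_le)
    finally show "(\<Sum>n\<in>F. 1 / real n) \<le> real b ^ 2 * real (k + 1)" .
  qed
qed auto

text \<open>Classification by the last digit: a number is a single digit, or a prefix followed by a
  digit, and only an appended \<open>d\<close> raises the count. Comparison with 1 / n gives the
  summability that the rearrangement needs.\<close>

lemma infsum_irwin_split:
  fixes f :: "nat \<Rightarrow> real"
  assumes f: "\<And>n. n > 0 \<Longrightarrow> 0 \<le> f n" "\<And>n. n > 0 \<Longrightarrow> f n \<le> 1 / real n"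
  shows "(\<Sum>\<^sub>\<infinity>n\<in>irwin_set b d k. f n) =
    (\<Sum>a | a \<in> {1..<b} \<and> k = (if a = d then 1 else 0). f a) +
    (\<Sum>a\<in>{..<b} - {d}. \<Sum>\<^sub>\<infinity>m\<in>irwin_set b d k. f (b * m + a)) +
    (if k > 0 then \<Sum>\<^sub>\<infinity>m\<in>irwin_set b d (k - 1). f (b * m + d) else 0)"
proof -
  have sm: "f summable_on irwin_set b d k"
    by (rule summable_on_comparison_test[OF summable_irwin]) (use f in \<open>auto simp: irwin_set_def\<close>)
  \<comment> \<open>Extension by zero lets the sum run over all of \<open>{b..}\<close>, where
    \<open>bij_append_digit\<close> separates prefix and last digit.\<close>
  let ?h = "\<lambda>n. if n \<in> irwin_set b d k then f n else 0"
  have h: "?h summable_on X" for X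
  proof (rule summable_on_subset_banach)
    show "?h summable_on UNIV"
      using summable_on_cong_neutral[of "irwin_set b d k" UNIV f ?h] sm by auto
  qed auto
  have "(\<Sum>\<^sub>\<infinity>n\<in>irwin_set b d k. f n) = (\<Sum>\<^sub>\<infinity>n\<in>{1..<b} \<union> {b..}. ?h n)"
    using b by (intro infsum_cong_neutral) (auto simp: irwin_set_def)
  also have "\<dots> = (\<Sum>n\<in>{1..<b}. ?h n) + (\<Sum>\<^sub>\<infinity>n\<in>{b..}. ?h n)"
    by (subst infsum_Un_disjoint[OF h h]) auto
  also have "(\<Sum>n\<in>{1..<b}. ?h n) = (\<Sum>a | a \<in> {1..<b} \<and> k = (if a = d then 1 else 0). f a)"
    unfolding sum.inter_filter[OF finite_atLeastLessThan, symmetric]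
    by (intro sum.cong) (auto simp: irwin_single)
  also have "(\<Sum>\<^sub>\<infinity>n\<in>{b..}. ?h n) = (\<Sum>\<^sub>\<infinity>(m, a)\<in>{1..} \<times> {..<b}. ?h (b * m + a))"
    by (subst infsum_reindex_bij_betw[OF bij_append_digit[OF b], symmetric]) (simp only: case_prod_unfold)
  also have "\<dots> = (\<Sum>\<^sub>\<infinity>a\<in>{..<b}. \<Sum>\<^sub>\<infinity>m\<in>{1..}. ?h (b * m + a))"
  proof -
    have s: "(\<lambda>(m, a). ?h (b * m + a)) summable_on {1..} \<times> {..<b}"
      using summable_on_reindex_bij_betw[OF bij_append_digit[OF b], of ?h] h[of "{b..}"]
      by (simp only: case_prod_unfold)
    show ?thesis
      unfolding infsum_Sigma'_banach[OF s, symmetric] by (rule infsum_swap_banach[OF s])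
  qed
  also have "\<dots> = (\<Sum>a<b. \<Sum>\<^sub>\<infinity>m\<in>{1..}. ?h (b * m + a))"
    by simp
  also have "\<dots> = (\<Sum>\<^sub>\<infinity>m\<in>{1..}. ?h (b * m + d)) + (\<Sum>a\<in>{..<b} - {d}. \<Sum>\<^sub>\<infinity>m\<in>{1..}. ?h (b * m + a))"
    using d by (subst sum.remove[of _ d]) auto
  also have "(\<Sum>\<^sub>\<infinity>m\<in>{1..}. ?h (b * m + d)) =
      (if k > 0 then \<Sum>\<^sub>\<infinity>m\<in>irwin_set b d (k - 1). f (b * m + d) else 0)"
  proof (cases "k > 0")
    case True
    have "(\<Sum>\<^sub>\<infinity>m\<in>{1..}. ?h (b * m + d)) = (\<Sum>\<^sub>\<infinity>m\<in>irwin_set b d (k - 1). f (b * m + d))"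
      using True d by (intro infsum_cong_neutral) (auto simp: irwin_append Suc_le_eq dest: irwin_pos)
    then show ?thesis using True by simp
  next
    case False
    then show ?thesis using d by (auto simp: irwin_append intro!: infsum_0)
  qed
  also have "(\<Sum>a\<in>{..<b} - {d}. \<Sum>\<^sub>\<infinity>m\<in>{1..}. ?h (b * m + a)) =
      (\<Sum>a\<in>{..<b} - {d}. \<Sum>\<^sub>\<infinity>m\<in>irwin_set b d k. f (b * m + a))"
  proof (intro sum.cong refl infsum_cong_neutral)
  qed (auto simp: irwin_append split: if_splits, auto simp: irwin_set_def)
  finally show ?thesis by simp
qed

section \<open>Integrals of reciprocal powers and their digit recursion\<close>

definition R :: "nat \<Rightarrow> nat \<Rightarrow> real" where
  "R j n = E j (\<lambda>x. 1 / (real n + x) ^ j)"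

text \<open>The probability of the digit times b ^ j (\<open>pmf_weight\<close>), where b ^ j comes
  from rescaling x to x / b in 1 / x ^ j.\<close>

definition weight :: "nat \<Rightarrow> nat \<Rightarrow> real" where
  "weight j a = (if a = d then 1 / lam b j else 1)"

lemma R_bounds:
  assumes j: "j \<ge> 1" and n: "n > 0"
  shows "0 \<le> R j n" "R j n \<le> 1 / real n"
proof -
  have "1 / (real n + x) ^ j \<le> 1 / real n" if "0 \<le> x" for x
  proof -
    have "real n \<le> real n + x" using that by simp
    also have "\<dots> \<le> (real n + x) ^ j" using that n j by (intro self_le_power) auto
    finally show ?thesis using n by (intro frac_le) auto
  qed
  then show "0 \<le> R j n" "R j n \<le> 1 / real n"
    unfolding R_def using j by (intro E_bounds[where B = "1 / real n"]; simp)+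
qed

lemma lam_pos:
  assumes "j \<ge> 1"
  shows "lam b j > 0"
proof -
  have "real b \<le> real b ^ j" using b assms by (intro self_le_power) auto
  then have "0 < real b ^ j - real b + 1" by linarith
  then show ?thesis by (simp only: lam_def zero_less_divide_1_iff)
qed

lemma pmf_weight: "j \<ge> 1 \<Longrightarrow> a < b \<Longrightarrow> pmf (digit_pmf b d j) a * real b ^ j = weight j a"
  using b by (simp add: pmf_digit_pmf[OF b d] weight_def lam_def)

text \<open>As n + (a + x) / b = (b n + a + x) / b, conditioning on the first digit of x appends
  that digit to \<open>n\<close>.\<close>

lemma R_append:
  assumes j: "j \<ge> 1" and n: "n > 0"
  shows "R j n = (\<Sum>a<b. weight j a * R j (b * n + a))"
proof -
  have "R j n = (\<Sum>a<b. pmf (digit_pmf b d j) a * E j (\<lambda>x. 1 / (real n + (real a + x) / real b) ^ j))"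
    unfolding R_def
    by (rule E_self_similar[OF j, where B = 1]) (use n in \<open>auto simp: one_le_power\<close>)
  also have "\<dots> = (\<Sum>a<b. weight j a * R j (b * n + a))"
  proof (rule sum.cong[OF refl])
    fix a assume "a \<in> {..<b}"
    have "1 / (real n + (real a + x) / real b) ^ j = real b ^ j * (1 / (real (b * n + a) + x) ^ j)" for x
    proof -
      have "real n + (real a + x) / real b = (real (b * n + a) + x) / real b"
        using b by (simp add: field_simps)
      then show ?thesis by (simp add: power_divide)
    qed
    then have "E j (\<lambda>x. 1 / (real n + (real a + x) / real b) ^ j) = real b ^ j * R j (b * n + a)"
      by (simp only: R_def integral_mult_right_zero)
    then show "pmf (digit_pmf b d j) a * E j (\<lambda>x. 1 / (real n + (real a + x) / real b) ^ j) =
        weight j a * R j (b * n + a)"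
      using pmf_weight[OF j, of a] \<open>a \<in> {..<b}\<close> by (metis lessThan_iff mult.assoc)
  qed
  finally show ?thesis .
qed

text \<open>Within [0, 1), \<open>X\<close> consists of the points with first digit in
  \<open>P\<close>, so \<open>E_self_similar\<close> keeps just these digits; \<open>low\<close>
  bounds the integrand by b ^ j. Both \<open>F\<close> and \<open>F_star\<close> have this
  form.\<close>

lemma set_integral_first_digit:
  assumes j: "j \<ge> 1" and X: "X \<in> sets borel" and P: "P \<subseteq> {1..<b}"
    and XP: "\<And>a x. a < b \<Longrightarrow> 0 \<le> x \<Longrightarrow> x < 1 \<Longrightarrow> (real a + x) / real b \<in> X \<longleftrightarrow> a \<in> P"
    and low: "X \<subseteq> {1 / real b..}"
  shows "(LINT x:X|nu b d j. 1 / x ^ j) = (\<Sum>a\<in>P. weight j a * R j a)"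
proof -
  let ?f = "\<lambda>x. indicator X x * (1 / x ^ j) :: real"
  have [measurable]: "?f \<in> borel_measurable borel" using X by measurable
  have "(LINT x:X|nu b d j. 1 / x ^ j) = E j ?f"
    by (simp add: set_lebesgue_integral_def)
  also have "\<dots> = (\<Sum>a<b. pmf (digit_pmf b d j) a * E j (\<lambda>x. ?f ((real a + x) / real b)))"
  proof (rule E_self_similar[OF j, where B = "1 / (1 / real b) ^ j"])
    fix x :: real assume "0 \<le> x" "x < 1"
    show "\<bar>?f x\<bar> \<le> 1 / (1 / real b) ^ j"
    proof (cases "x \<in> X")
      case True
      then have x: "1 / real b \<le> x" using low by auto
      moreover have "0 < 1 / real b" using b by simp
      ultimately have "1 / x ^ j \<le> 1 / (1 / real b) ^ j"
        by (intro frac_le power_mono zero_less_power) auto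
      then show ?thesis using True \<open>0 \<le> x\<close> by simp
    qed simp
  qed measurable
  also have "\<dots> = (\<Sum>a<b. if a \<in> P then weight j a * R j a else 0)"
  proof (rule sum.cong[OF refl])
    fix a assume a: "a \<in> {..<b}"
    have "E j (\<lambda>x. ?f ((real a + x) / real b)) =
        E j (\<lambda>x. if a \<in> P then real b ^ j * (1 / (real a + x) ^ j) else 0)"
    proof (rule E_cong[OF j])
      show "(\<lambda>x. ?f ((real a + x) / real b)) \<in> borel_measurable borel"
        by measurable
    qed (use XP a in \<open>auto simp: power_divide\<close>)
    also have "\<dots> = (if a \<in> P then real b ^ j * R j a else 0)"
    proof (cases "a \<in> P")
      case True
      then show ?thesis by (simp only: if_True R_def integral_mult_right_zero)
    qed simp
    finally show "pmf (digit_pmf b d j) a * E j (\<lambda>x. ?f ((real a + x) / real b)) =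
        (if a \<in> P then weight j a * R j a else 0)"
      using pmf_weight[OF j, of a] a by (simp add: mult.assoc[symmetric])
  qed
  also have "\<dots> = (\<Sum>a\<in>P. weight j a * R j a)"
    using P by (intro sum.mono_neutral_cong_right) auto
  finally show ?thesis .
qed

lemma append_digit_le_iff:
  fixes x :: real
  assumes "a < b" "0 \<le> x" "x < 1"
  shows "real e / real b \<le> (real a + x) / real b \<longleftrightarrow> e \<le> a"
    and "(real a + x) / real b < (real e + 1) / real b \<longleftrightarrow> a \<le> e"
  using assms b by (auto simp: divide_le_cancel divide_less_cancel)

lemma F_eq:
  assumes j: "j \<ge> 1"
  shows "F b d j = (\<Sum>a\<in>{1..<b}. weight j a * R j a)"
  unfolding F_def
proof (rule set_integral_first_digit[OF j])
  show "(real a + x) / real b \<in> {1 / real b..<1} \<longleftrightarrow> a \<in> {1..<b}"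
    if "a < b" "0 \<le> x" "x < 1" for a x
    using append_digit_le_iff(1)[OF that, of 1] digit_interval[OF that] that by auto
qed auto

lemma F_star_eq:
  assumes j: "j \<ge> 1"
  shows "F_star b d j = (\<Sum>a\<in>{1..<b} - {d}. R j a)"
proof -
  have "F_star b d j = (\<Sum>a\<in>{1..<b} - {d}. weight j a * R j a)"
    unfolding F_star_def
  proof (rule set_integral_first_digit[OF j])
    show "(real a + x) / real b \<in> {1 / real b..<1} - {real d / real b..<(real d + 1) / real b} \<longleftrightarrow>
        a \<in> {1..<b} - {d}" if "a < b" "0 \<le> x" "x < 1" for a x
      using append_digit_le_iff(1)[OF that, of 1] append_digit_le_iff[OF that, of d] digit_interval[OF that] that
      by auto
  qed auto
  then show ?thesis by (simp add: weight_def)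
qed

text \<open>The factor of \<open>c b d j\<close> once the expansions of 1 / (b n) are summed over
  n.\<close>

definition G :: "nat \<Rightarrow> nat \<Rightarrow> real" where
  "G j k = (\<Sum>\<^sub>\<infinity>n\<in>irwin_set b d k. R j (b * n + d))"

text \<open>The sum of \<open>R j n\<close> over \<open>irwin_set b d k\<close> is computed twice, by self-similarity of \<open>nu b d j\<close>
  and by splitting off the last digit of \<open>n\<close>; the terms with a last digit other than \<open>d\<close> cancel.\<close>

lemma G_rec:
  assumes j: "j \<ge> 1"
  shows "G j k = lam b j * ((\<Sum>a | a \<in> {1..<b} \<and> k = (if a = d then 1 else 0). R j a) +
    (if k > 0 then G j (k - 1) else 0))"
proof -
  let ?A = "irwin_set b d k"
  have sm: "(\<lambda>n. R j (b * n + a)) summable_on ?A" for a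
  proof (rule summable_on_comparison_test[OF summable_irwin])
    fix n assume "n \<in> ?A"
    then have n: "n > 0" by (rule irwin_pos)
    then have "R j (b * n + a) \<le> 1 / real (b * n + a)"
      using b by (intro R_bounds j) simp
    also have "\<dots> \<le> 1 / real n"
      using n b by (intro frac_le) (auto simp flip: of_nat_mult of_nat_add intro: trans_le_add1)
    finally show "R j (b * n + a) \<le> 1 / real n" .
    show "0 \<le> R j (b * n + a)" using n b by (intro R_bounds j) simp
  qed
  define T where "T = (\<Sum>a\<in>{..<b} - {d}. \<Sum>\<^sub>\<infinity>n\<in>?A. R j (b * n + a))"
  have "(\<Sum>\<^sub>\<infinity>n\<in>?A. R j n) = (\<Sum>\<^sub>\<infinity>n\<in>?A. \<Sum>a<b. weight j a * R j (b * n + a))"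
    by (intro infsum_cong R_append j) (rule irwin_pos)
  also have "\<dots> = (\<Sum>a<b. \<Sum>\<^sub>\<infinity>n\<in>?A. weight j a * R j (b * n + a))"
    by (intro infsum_sum_swap summable_on_cmult_right sm) auto
  also have "\<dots> = (\<Sum>a<b. weight j a * (\<Sum>\<^sub>\<infinity>n\<in>?A. R j (b * n + a)))"
    by (simp add: infsum_cmult_right')
  also have "\<dots> = 1 / lam b j * G j k + T"
    unfolding T_def G_def using d by (subst sum.remove[of _ d]) (auto simp: weight_def)
  finally have "1 / lam b j * G j k + T =
      (\<Sum>a | a \<in> {1..<b} \<and> k = (if a = d then 1 else 0). R j a) + T +
      (if k > 0 then G j (k - 1) else 0)"
    using infsum_irwin_split[OF R_bounds[OF j], of k] by (simp only: T_def G_def)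
  then have "1 / lam b j * G j k = (\<Sum>a | a \<in> {1..<b} \<and> k = (if a = d then 1 else 0). R j a) +
      (if k > 0 then G j (k - 1) else 0)" (is "_ = ?r")
    by linarith
  moreover have "G j k = lam b j * (1 / lam b j * G j k)"
    using lam_pos[OF j] by simp
  ultimately show ?thesis by (simp only:)
qed

lemma G_0:
  assumes j: "j \<ge> 1"
  shows "G j 0 = F_star b d j * lam b j"
proof -
  have "{a. a \<in> {1..<b} \<and> 0 = (if a = d then 1 else 0 :: nat)} = {1..<b} - {d}"
    by auto
  then show ?thesis
    using G_rec[OF j, of 0] F_star_eq[OF j] by simp
qed

text \<open>For d > 0 the leading digit \<open>d\<close> has weight 1 / \<open>lam b j\<close> in
  \<open>F\<close> and is missing from \<open>F_star\<close>. For d = 0 it cannot lead, so the two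
  agree, and k = 0 then falls under the formula with \<open>F\<close>.\<close>

lemma F_F_star:
  assumes j: "j \<ge> 1"
  shows "F b d j = F_star b d j + (if d > 0 then R j d / lam b j else 0)"
proof (cases "d > 0")
  case True
  then show ?thesis
    unfolding F_eq[OF j] F_star_eq[OF j] using d
    by (subst sum.remove[of _ d]) (auto simp: weight_def)
next
  case False
  have "weight j a = 1" if "a \<noteq> d" for a
    using that by (simp add: weight_def)
  then have "(\<Sum>a\<in>{1..<b}. weight j a * R j a) = (\<Sum>a\<in>{1..<b} - {d}. R j a)"
    using False by (intro sum.cong) auto
  then show ?thesis
    by (simp only: F_eq[OF j] F_star_eq[OF j] False if_False add_0_right)
qed

text \<open>At count 1 the single digit \<open>d\<close>, if positive, joins \<open>G j 0\<close>,
  and \<open>F_F_star\<close> combines the two into \<open>F\<close>. From count 2 on no single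
  digit contributes, so \<open>G_rec\<close> only multiplies by \<open>lam b j\<close>.\<close>

lemma G_Suc:
  assumes j: "j \<ge> 1"
  shows "G j (Suc k) = F b d j * lam b j ^ (k + 2)"
proof (induction k)
  case 0
  have "{a. a \<in> {1..<b} \<and> Suc 0 = (if a = d then 1 else 0)} = (if d > 0 then {d} else {})"
    using d by auto
  then have "G j 1 = lam b j * ((if d > 0 then R j d else 0) + F_star b d j * lam b j)"
    using G_rec[OF j, of 1] G_0[OF j] by simp
  then show ?case
    using lam_pos[OF j] by (simp add: F_F_star[OF j] power2_eq_square field_simps)
next
  case (Suc k)
  have "{a. a \<in> {1..<b} \<and> Suc (Suc k) = (if a = d then 1 else 0)} = {}"
    by auto
  then show ?case
    using G_rec[OF j, of "Suc (Suc k)"] Suc by (simp add: mult_ac)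
qed

text \<open>The expansion \<open>c_resolvent\<close> applies at z = b n \<ge> 2, and its bound of
  order 1 / n is summable over \<open>irwin_set b d k\<close>, so the sums over n and j may be
  swapped.\<close>

lemma irwin_series:
  "summable (\<lambda>j. \<bar>c b d (Suc j) * G (Suc j) k\<bar>)"
  "1 / real b * irwin_sum b d k = (\<Sum>j. c b d (Suc j) * G (Suc j) k)"
proof -
  obtain K where K: "\<And>n. \<bar>c b d (Suc n)\<bar> \<le> K * \<rho> ^ n"
    using c_bound by blast
  let ?A = "irwin_set b d k"
  let ?f = "\<lambda>n j. c b d (Suc j) * R (Suc j) (b * n + d)"
  have z: "real b * real n \<ge> 2" if "n \<in> ?A" for n
  proof -
    have "2 * 1 \<le> b * n" using b irwin_pos[OF that] by (intro mult_le_mono) auto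
    then show ?thesis by (metis mult_1_right of_nat_le_iff of_nat_mult of_nat_numeral)
  qed
  have res: "summable (\<lambda>j. \<bar>?f n j\<bar>)" "(\<Sum>j. \<bar>?f n j\<bar>) \<le> K / (real b * real n - 3 / 2)"
    "?f n sums (1 / (real b * real n))" if "n \<in> ?A" for n
    using c_resolvent[OF K, of "real b * real n"] z[OF that] by (simp_all add: R_def)
  have K0: "K \<ge> 0" using K[of 0] by simp
  have le: "(\<Sum>j. \<bar>?f n j\<bar>) \<le> (1 / real n) * (4 * K / real b)" if "n \<in> ?A" for n
  proof -
    \<comment> \<open>The inequality b n - 3 / 2 \<ge> b n / 4 is equivalent to b n \<ge> 2.\<close>
    have "K / (real b * real n - 3 / 2) \<le> K / (real b * real n / 4)"
      using z[OF that] K0 by (intro divide_left_mono) auto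
    then show ?thesis using res(2)[OF that] by (simp add: mult_ac)
  qed
  have sm: "(\<lambda>n. (1 / real n) * (4 * K / real b)) summable_on ?A"
    by (rule summable_on_cmult_left) (rule summable_irwin)
  have G: "(\<Sum>\<^sub>\<infinity>n\<in>?A. ?f n j) = c b d (Suc j) * G (Suc j) k" for j
    by (simp add: G_def infsum_cmult_right')
  show "summable (\<lambda>j. \<bar>c b d (Suc j) * G (Suc j) k\<bar>)"
    using sums_infsum_swap(1)[OF res(1) le sm] by (simp only: G)
  have "(\<lambda>j. c b d (Suc j) * G (Suc j) k) sums (\<Sum>\<^sub>\<infinity>n\<in>?A. \<Sum>j. ?f n j)"
    using sums_infsum_swap(2)[OF res(1) le sm] by (simp only: G)
  also have "(\<Sum>\<^sub>\<infinity>n\<in>?A. \<Sum>j. ?f n j) = (\<Sum>\<^sub>\<infinity>n\<in>?A. 1 / real b * (1 / real n))"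
    using sums_unique[OF res(3)] by (intro infsum_cong) simp
  also have "\<dots> = 1 / real b * irwin_sum b d k"
    unfolding irwin_sum_def by (rule infsum_cmult_right')
  finally show "1 / real b * irwin_sum b d k = (\<Sum>j. c b d (Suc j) * G (Suc j) k)"
    by (rule sums_unique)
qed

end

theorem theorem2:
  fixes b d :: nat
  assumes "b > 1" and "d < b"
  shows "(\<forall>k::nat. k \<ge> 1 \<or> (k = 0 \<and> d = 0) \<longrightarrow>
            (\<lambda>n. 1 / real n) summable_on irwin_set b d k \<and>
            summable (\<lambda>j. \<bar>c b d (Suc j) * F b d (Suc j) * lam b (Suc j) ^ (k + 1)\<bar>) \<and>
            1 / real b * irwin_sum b d k =
              (\<Sum>j. c b d (Suc j) * F b d (Suc j) * lam b (Suc j) ^ (k + 1)))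
       \<and> (d > 0 \<and> (b, d) \<noteq> (2, 1) \<longrightarrow>
            (\<lambda>n. 1 / real n) summable_on irwin_set b d 0 \<and>
            summable (\<lambda>j. \<bar>c b d (Suc j) * F_star b d (Suc j) * lam b (Suc j)\<bar>) \<and>
            1 / real b * irwin_sum b d 0 =
              (\<Sum>j. c b d (Suc j) * F_star b d (Suc j) * lam b (Suc j)))"
proof (intro conjI allI impI)
  fix k :: nat assume k: "k \<ge> 1 \<or> (k = 0 \<and> d = 0)"
  have "G b d (Suc j) k = F b d (Suc j) * lam b (Suc j) ^ (k + 1)" for j
  proof (cases k)
    \<comment> \<open>Here d = 0, where \<open>F\<close> and \<open>F_star\<close> agree.\<close>
    case 0
    then show ?thesis
      using k G_0[OF assms, of "Suc j"] F_F_star[OF assms, of "Suc j"] by simp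
  next
    case (Suc k')
    then show ?thesis
      using G_Suc[OF assms, of "Suc j" k'] by simp
  qed
  then have eq: "c b d (Suc j) * F b d (Suc j) * lam b (Suc j) ^ (k + 1) = c b d (Suc j) * G b d (Suc j) k" for j
    by simp
  show "(\<lambda>n. 1 / real n) summable_on irwin_set b d k"
    by (rule summable_irwin[OF assms])
  show "summable (\<lambda>j. \<bar>c b d (Suc j) * F b d (Suc j) * lam b (Suc j) ^ (k + 1)\<bar>)"
    "1 / real b * irwin_sum b d k =
      (\<Sum>j. c b d (Suc j) * F b d (Suc j) * lam b (Suc j) ^ (k + 1))"
    unfolding eq by (rule irwin_series[OF assms])+
next
  have eq: "c b d (Suc j) * F_star b d (Suc j) * lam b (Suc j) = c b d (Suc j) * G b d (Suc j) 0" for j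
    using G_0[OF assms, of "Suc j"] by simp
  show "(\<lambda>n. 1 / real n) summable_on irwin_set b d 0"
    by (rule summable_irwin[OF assms])
  show "summable (\<lambda>j. \<bar>c b d (Suc j) * F_star b d (Suc j) * lam b (Suc j)\<bar>)"
    "1 / real b * irwin_sum b d 0 = (\<Sum>j. c b d (Suc j) * F_star b d (Suc j) * lam b (Suc j))"
    unfolding eq by (rule irwin_series[OF assms])+
qed

end
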